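(* For each integer $q\ge 3$ let $\bar{\bf x}^q=(1,2,\dots,q)'\in\mathbb{R}^q$ and $\bar{\bf y}^q=\bar{\bf x}^q-\frac{q+1}{2}{\bf e}^q=\left(-\frac{q-1}{2},-\frac{q-3}{2},\dots,\frac{q-3}{2},\frac{q-1}{2}\right)'$. The sequences of regular configurations $\{\bar{\bf x}^q\}$ and $\{\bar{\bf y}^q\}$ are not asymptotically permutation-full (APF), hence not asymptotically permutation-uniform (APU) and not asymptotically permutation-dense (APD).
   Context: Superscripts $q$ on vectors are indices. ${\bf e}^q=(1,\dots,1)'\in\mathbb{R}^q$; $\|\cdot\|$ is the Euclidean norm. $\widetilde{\mathcal M}^{q-1}=\{{\bf v}\in\mathbb{R}^q : {\bf v}'{\bf e}^q=0\}$, and $\widetilde{\mathcal M}^{q-1}_{\le}$ is the set of ${\bf v}\in\widetilde{\mathcal M}^{q-1}$ with $v_1\le\cdots\le v_q$. For ${\bf y}\in\mathbb{R}^q$, $\Pi({\bf y})=\{P{\bf y} : P \text{ a } q\times q \text{ permutation matrix}\}$. For $\rho>0$, $\widetilde{\mathcal S}^{q-2}_\rho=\{{\bf v}\in\widetilde{\mathcal M}^{q-1}:\|{\bf v}\|=\rho\}$, and $\widetilde{\bf U}^{q-2}_\rho$ is the uniform (normalized rotation-invariant) probability measure on $\widetilde{\mathcal S}^{q-2}_\rho$. For nonzero ${\bf w}\in\widetilde{\mathcal M}^{q-1}$ and $-1\le t<1$, the open spherical cap of angular half-width $\cos^{-1}(t)$ centered at ${\bf w}$ is $C({\bf w};t)=\{{\bf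 v}\in\widetilde{\mathcal S}^{q-2}_{\|{\bf w}\|}:{\bf v}'{\bf w}>\|{\bf w}\|^2t\}$; $\widetilde{\mathcal C}^{q-2}_\rho$ is the set of all caps $C({\bf w};t)$ with ${\bf w}\in\widetilde{\mathcal S}^{q-2}_\rho$, $-1\le t<1$. For a nonempty finite $N\subset\widetilde{\mathcal S}^{q-2}_\rho$ define: $D^{q-2}(N)=\sup\{\,|\,|N\cap C|/|N|-\widetilde{\bf U}^{q-2}_\rho(C)\,| : C\in\widetilde{\mathcal C}^{q-2}_\rho\}$ (normalized spherical cap discrepancy); $L^{q-2}(N)=\sup\{\widetilde{\bf U}^{q-2}_\rho(C): C\in\widetilde{\mathcal C}^{q-2}_\rho,\ N\cap C=\emptyset\}$ (largest empty cap discrepancy); $A^{q-2}(N)=\sup\{\cos^{-1}(t): \exists\,{\bf w}\in\widetilde{\mathcal S}^{q-2}_\rho,\ -1\le t<1,\ N\cap C({\bf w};t)=\emptyset\}$ (largest empty cap angular discrepancy). A sequence of nonzero vectors $\{{\bf y}^q\in\widetilde{\mathcal M}^{q-1}_{\le}\}$ ($q$ varying) is APU if $\lim_{q\to\infty}D^{q-2}(\Pi({\bf y}^q))=0$, APF if $\lim_{q\to\infty}L^{q-2}(\Pi({\bf y}^q))=0$, and APD if $\lim_{q\to\infty}A^{q-2}(\Pi({\bf y}^q))=0$. For a sequence ${\bf x}^q\in\mathbb{R}^q$ with ordered components $x^q_1\le\cdots\le x^q_q$ (not all equal), each property means the same property for its projections ${\bf x}^q-\left(\frac1q\sum_i x_i^q\right){\bf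 e}^q$ onto $\widetilde{\mathcal M}^{q-1}$ (so $\Pi({\bf x}^q)$ is a rigid translate of the set of permutations of the projection). *)

theory Defs
  imports "HOL-Probability.Probability"
begin

text \<open>
  The dimension \<open>q\<close> varies within the statement, so vectors of $\mathbb{R}^q$ are functions
  \<open>nat \<Rightarrow> real\<close> vanishing outside \<open>{1..q}\<close>; components are numbered from 1. The sequences of
  vectors are functions of \<open>q\<close>. Their values for \<open>q < 3\<close> have no influence on any limit.
\<close>

definition Rvec :: "nat \<Rightarrow> (nat \<Rightarrow> real) set" where
  "Rvec q = {v. \<forall>i. i \<notin> {1..q} \<longrightarrow> v i = 0}"

definition dotp :: "nat \<Rightarrow> (nat \<Rightarrow> real) \<Rightarrow> (nat \<Rightarrow> real) \<Rightarrow> real" where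
  "dotp q v w = (\<Sum>i=1..q. v i * w i)"

abbreviation enorm :: "nat \<Rightarrow> (nat \<Rightarrow> real) \<Rightarrow> real" where
  "enorm q v \<equiv> L2_set v {1..q}"

definition evec :: "nat \<Rightarrow> nat \<Rightarrow> real" where
  "evec q = (\<lambda>i. if i \<in> {1..q} then 1 else 0)"

definition hyper :: "nat \<Rightarrow> (nat \<Rightarrow> real) set" where
  "hyper q = {v \<in> Rvec q. dotp q v (evec q) = 0}"

definition hyper_le :: "nat \<Rightarrow> (nat \<Rightarrow> real) set" where
  "hyper_le q = {v \<in> hyper q. mono_on {1..q} v}"

text \<open>For \<open>x \<in> Rvec q\<close> this is the orthogonal projection of \<open>x\<close> onto \<open>hyper q\<close>.\<close>

definition proj :: "nat \<Rightarrow> (nat \<Rightarrow> real) \<Rightarrow> nat \<Rightarrow> real" where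
  "proj q x = (\<lambda>i. if i \<in> {1..q} then x i - (\<Sum>j=1..q. x j) / real q else 0)"

text \<open>Multiplication by a permutation matrix permutes the components.\<close>

definition perms :: "nat \<Rightarrow> (nat \<Rightarrow> real) \<Rightarrow> (nat \<Rightarrow> real) set" where
  "perms q y = {y \<circ> \<pi> | \<pi>. \<pi> permutes {1..q}}"

definition sphere_hyper :: "nat \<Rightarrow> real \<Rightarrow> (nat \<Rightarrow> real) set" where
  "sphere_hyper q \<rho> = {v \<in> hyper q. enorm q v = \<rho>}"


subsection \<open>The uniform distribution on the sphere\<close>

text \<open>
  Linear isometries of \<open>hyper q\<close> onto itself (values outside \<open>hyper q\<close> are irrelevant). Improper
  ones are included: for \<open>q \<ge> 3\<close> the proper ones already act transitively on the sphere, and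
  invariance under either group determines the same probability measure.
\<close>

definition lin_isom :: "nat \<Rightarrow> ((nat \<Rightarrow> real) \<Rightarrow> nat \<Rightarrow> real) \<Rightarrow> bool" where
  "lin_isom q f \<longleftrightarrow> f ` hyper q = hyper q \<and>
     (\<forall>v\<in>hyper q. \<forall>w\<in>hyper q. f (\<lambda>i. v i + w i) = (\<lambda>i. f v i + f w i)) \<and>
     (\<forall>c. \<forall>v\<in>hyper q. f (\<lambda>i. c * v i) = (\<lambda>i. c * f v i)) \<and>
     (\<forall>v\<in>hyper q. enorm q (f v) = enorm q v)"

text \<open>
  \<open>borel\<close> belongs to the product topology on \<open>nat \<Rightarrow> real\<close>, which induces the Euclidean topology
  on \<open>Rvec q\<close>.
\<close>

definition rot_invariant_prob :: "nat \<Rightarrow> real \<Rightarrow> (nat \<Rightarrow> real) measure \<Rightarrow> bool" where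
  "rot_invariant_prob q \<rho> U \<longleftrightarrow> prob_space U \<and>
     sets U = sets (restrict_space borel (sphere_hyper q \<rho>)) \<and>
     (\<forall>f. lin_isom q f \<longrightarrow> distr U U f = U)"

text \<open>Existence and uniqueness are shown in \<open>rot_ex1\<close> below.\<close>

definition unif_sphere :: "nat \<Rightarrow> real \<Rightarrow> (nat \<Rightarrow> real) measure" where
  "unif_sphere q \<rho> = (THE U. rot_invariant_prob q \<rho> U)"


subsection \<open>Spherical caps and discrepancies\<close>

definition cap :: "nat \<Rightarrow> (nat \<Rightarrow> real) \<Rightarrow> real \<Rightarrow> (nat \<Rightarrow> real) set" where
  "cap q w t = {v \<in> sphere_hyper q (enorm q w). dotp q v w > (enorm q w)\<^sup>2 * t}"

definition caps :: "nat \<Rightarrow> real \<Rightarrow> (nat \<Rightarrow> real) set set" where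
  "caps q \<rho> = {cap q w t | w t. w \<in> sphere_hyper q \<rho> \<and> -1 \<le> t \<and> t < 1}"

text \<open>
  For \<open>q \<ge> 3\<close>, \<open>\<rho> > 0\<close> and finite nonempty \<open>N \<subseteq> sphere_hyper q \<rho>\<close> the suprema below are over
  nonempty bounded sets of reals.
\<close>

definition cap_discrepancy :: "nat \<Rightarrow> real \<Rightarrow> (nat \<Rightarrow> real) set \<Rightarrow> real" where
  "cap_discrepancy q \<rho> N =
     Sup {\<bar>real (card (N \<inter> C)) / real (card N) - measure (unif_sphere q \<rho>) C\<bar> | C. C \<in> caps q \<rho>}"

definition empty_cap_discrepancy :: "nat \<Rightarrow> real \<Rightarrow> (nat \<Rightarrow> real) set \<Rightarrow> real" where
  "empty_cap_discrepancy q \<rho> N =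
     Sup {measure (unif_sphere q \<rho>) C | C. C \<in> caps q \<rho> \<and> N \<inter> C = {}}"

definition empty_cap_angular_discrepancy :: "nat \<Rightarrow> real \<Rightarrow> (nat \<Rightarrow> real) set \<Rightarrow> real" where
  "empty_cap_angular_discrepancy q \<rho> N =
     Sup {arccos t | t. \<exists>w\<in>sphere_hyper q \<rho>. -1 \<le> t \<and> t < 1 \<and> N \<inter> cap q w t = {}}"


subsection \<open>Asymptotic properties of sequences of vectors\<close>

text \<open>
  \<open>APU\<close>, \<open>APF\<close>, \<open>APD\<close> are meant for sequences of nonzero vectors \<open>y q \<in> hyper_le q\<close>. This is not
  made part of the predicates, so that their negations do assert failure of convergence. All
  permutations of \<open>y q\<close> lie on the sphere of radius \<open>enorm q (y q)\<close>.
\<close>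

definition APU :: "(nat \<Rightarrow> nat \<Rightarrow> real) \<Rightarrow> bool" where
  "APU y \<longleftrightarrow> (\<lambda>q. cap_discrepancy q (enorm q (y q)) (perms q (y q))) \<longlonglongrightarrow> 0"

definition APF :: "(nat \<Rightarrow> nat \<Rightarrow> real) \<Rightarrow> bool" where
  "APF y \<longleftrightarrow> (\<lambda>q. empty_cap_discrepancy q (enorm q (y q)) (perms q (y q))) \<longlonglongrightarrow> 0"

definition APD :: "(nat \<Rightarrow> nat \<Rightarrow> real) \<Rightarrow> bool" where
  "APD y \<longleftrightarrow> (\<lambda>q. empty_cap_angular_discrepancy q (enorm q (y q)) (perms q (y q))) \<longlonglongrightarrow> 0"

text \<open>The same properties for sequences of ordered vectors that need not have mean zero.\<close>

definition APU_proj :: "(nat \<Rightarrow> nat \<Rightarrow> real) \<Rightarrow> bool" where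
  "APU_proj x \<longleftrightarrow> APU (\<lambda>q. proj q (x q))"

definition APF_proj :: "(nat \<Rightarrow> nat \<Rightarrow> real) \<Rightarrow> bool" where
  "APF_proj x \<longleftrightarrow> APF (\<lambda>q. proj q (x q))"

definition APD_proj :: "(nat \<Rightarrow> nat \<Rightarrow> real) \<Rightarrow> bool" where
  "APD_proj x \<longleftrightarrow> APD (\<lambda>q. proj q (x q))"

definition xbar :: "nat \<Rightarrow> nat \<Rightarrow> real" where
  "xbar q = (\<lambda>i. if i \<in> {1..q} then real i else 0)"

definition ybar :: "nat \<Rightarrow> nat \<Rightarrow> real" where
  "ybar q = (\<lambda>i. xbar q i - (real q + 1) / 2 * evec q i)"


subsection \<open>Lebesgue and Gaussian measure on coordinate space are rotation invariant\<close>

definition LB :: "nat \<Rightarrow> (nat \<Rightarrow> real) measure" where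
  "LB q = PiM {1..q} (\<lambda>_. lborel)"

interpretation lbp: product_sigma_finite "\<lambda>_::nat. lborel :: real measure"
  by standard

lemma LB_sigma_finite: "sigma_finite_measure (LB q)"
  unfolding LB_def by (rule lbp.sigma_finite) simp

lemma space_LB: "space (LB q) = Pi\<^sub>E {1..q} (\<lambda>_. UNIV)"
  by (simp add: LB_def space_PiM)

lemma LB_comp [measurable (raw)]:
  assumes "g \<in> measurable N (LB q)" "i \<in> {1..q}"
  shows "(\<lambda>x. g x i) \<in> borel_measurable N"
  using measurable_compose[OF assms(1)[unfolded LB_def] measurable_component_singleton[OF assms(2)]]
  by simp

lemma LB_coord: "i \<in> {1..q} \<Longrightarrow> (\<lambda>x. x i) \<in> borel_measurable (LB q)"
  by (rule LB_comp) auto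

lemma LB_restrict [measurable (raw)]:
  assumes "\<And>i. i \<in> {1..q} \<Longrightarrow> (\<lambda>x. f x i) \<in> borel_measurable N"
  shows "(\<lambda>x. \<lambda>i\<in>{1..q}. f x i) \<in> measurable N (LB q)"
  unfolding LB_def using assms by (intro measurable_restrict) simp

lemma LB_translate:
  assumes a: "a \<in> space (LB q)"
  shows "distr (LB q) (LB q) (\<lambda>x. \<lambda>i\<in>{1..q}. x i + a i) = LB q" (is "?D = _")
proof -
  have "?D = PiM {1..q} (\<lambda>_. lborel)"
  proof (rule lbp.PiM_eqI)
    fix A :: "nat \<Rightarrow> real set" assume A: "\<And>i. i \<in> {1..q} \<Longrightarrow> A i \<in> sets lborel"
    have [measurable]: "(\<lambda>x. \<lambda>i\<in>{1..q}. x i + a i) \<in> measurable (LB q) (LB q)"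
      by measurable
    have B: "(\<lambda>x. x + a i) -` A i \<in> sets lborel" if "i \<in> {1..q}" for i
      using measurable_sets[of "\<lambda>x. x + a i" borel borel "A i"] A[OF that] by simp
    have "emeasure ?D (Pi\<^sub>E {1..q} A)
        = emeasure (LB q) ((\<lambda>x. \<lambda>i\<in>{1..q}. x i + a i) -` (Pi\<^sub>E {1..q} A) \<inter> space (LB q))"
      using A by (intro emeasure_distr) (auto simp: LB_def intro!: sets_PiM_I_finite)
    also have "(\<lambda>x. \<lambda>i\<in>{1..q}. x i + a i) -` (Pi\<^sub>E {1..q} A) \<inter> space (LB q)
        = (Pi\<^sub>E {1..q} (\<lambda>i. (\<lambda>x. x + a i) -` A i))"
      by (auto simp: space_LB PiE_iff)
    also have "emeasure (LB q) \<dots> = (\<Prod>i\<in>{1..q}. emeasure lborel ((\<lambda>x. x + a i) -` A i))"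
      using B unfolding LB_def by (intro lbp.emeasure_PiM) auto
    also have "\<dots> = (\<Prod>i\<in>{1..q}. emeasure lborel (A i))"
    proof (rule prod.cong)
      fix i assume i: "i \<in> {1..q}"
      have "emeasure lborel (A i) = emeasure (distr lborel borel ((+) (a i))) (A i)"
        by (simp add: lborel_distr_plus)
      also have "\<dots> = emeasure lborel ((\<lambda>x. x + a i) -` A i)"
        using A[OF i] by (subst emeasure_distr) (auto simp: add.commute vimage_def)
      finally show "emeasure lborel ((\<lambda>x. x + a i) -` A i) = emeasure lborel (A i)" by simp
    qed simp
    finally show "emeasure ?D (Pi\<^sub>E {1..q} A) = (\<Prod>i\<in>{1..q}. emeasure lborel (A i))" .
  qed (auto simp: LB_def)
  then show ?thesis by (simp only: LB_def)
qed

lemma LB_nn_translate: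
  assumes a: "a \<in> space (LB q)" and [measurable]: "F \<in> borel_measurable (LB q)"
  shows "(\<integral>\<^sup>+x. F (\<lambda>i\<in>{1..q}. x i + a i) \<partial>LB q) = (\<integral>\<^sup>+x. F x \<partial>LB q)"
proof -
  have "(\<integral>\<^sup>+x. F x \<partial>LB q) = (\<integral>\<^sup>+x. F x \<partial>(distr (LB q) (LB q) (\<lambda>x. \<lambda>i\<in>{1..q}. x i + a i)))"
    by (simp only: LB_translate[OF a])
  also have "\<dots> = (\<integral>\<^sup>+x. F (\<lambda>i\<in>{1..q}. x i + a i) \<partial>LB q)"
    by (rule nn_integral_distr) measurable
  finally show ?thesis by simp
qed

definition gdens :: "nat \<Rightarrow> (nat \<Rightarrow> real) \<Rightarrow> ennreal" where
  "gdens q x = (\<Prod>i\<in>{1..q}. ennreal (std_normal_density (x i)))"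

lemma gdens_meas [measurable]: "gdens q \<in> borel_measurable (LB q)"
  unfolding gdens_def by measurable

lemma std_normal_int: "(\<integral>\<^sup>+x. ennreal (std_normal_density x) \<partial>lborel) = 1"
  by (subst nn_integral_eq_integral)
     (auto simp: integral_normal_density integrable_normal_density)

lemma gdens_int: "(\<integral>\<^sup>+x. gdens q x \<partial>LB q) = 1"
  unfolding gdens_def LB_def by (subst lbp.product_nn_integral_prod) (auto simp: std_normal_int)

lemma gdens_norm: "gdens q x = ennreal ((1 / sqrt (2 * pi)) ^ q * exp (- dotp q x x / 2))"
proof -
  have "gdens q x = ennreal (\<Prod>i\<in>{1..q}. std_normal_density (x i))"
    unfolding gdens_def by (rule prod_ennreal) simp
  also have "(\<Prod>i\<in>{1..q}. std_normal_density (x i))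
      = (1 / sqrt (2 * pi)) ^ q * exp (\<Sum>i\<in>{1..q}. - (x i)\<^sup>2 / 2)"
    unfolding std_normal_density_def prod.distrib by (simp add: exp_sum)
  also have "(\<Sum>i\<in>{1..q}. - (x i)\<^sup>2 / 2) = - dotp q x x / 2"
    by (simp add: dotp_def sum_negf power2_eq_square flip: sum_divide_distrib)
  finally show ?thesis .
qed

lemma LB_isom_invariant:
  fixes T :: "(nat \<Rightarrow> real) \<Rightarrow> nat \<Rightarrow> real"
  assumes T [measurable]: "T \<in> measurable (LB q) (LB q)"
    and add: "\<And>x y. x \<in> space (LB q) \<Longrightarrow> y \<in> space (LB q) \<Longrightarrow>
      T (\<lambda>i\<in>{1..q}. x i + y i) = (\<lambda>i\<in>{1..q}. T x i + T y i)"
    and nrm: "\<And>x. x \<in> space (LB q) \<Longrightarrow> dotp q (T x) (T x) = dotp q x x"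
    and surj: "\<And>y. y \<in> space (LB q) \<Longrightarrow> \<exists>x\<in>space (LB q). T x = y"
    and [measurable]: "F \<in> borel_measurable (LB q)"
  shows "(\<integral>\<^sup>+x. F (T x) \<partial>LB q) = (\<integral>\<^sup>+x. F x \<partial>LB q)"
proof -
  interpret L: sigma_finite_measure "LB q" by (rule LB_sigma_finite)
  interpret LL: pair_sigma_finite "LB q" "LB q" by standard
  have ext: "(\<lambda>i\<in>{1..q}. x i) = x" if "x \<in> space (LB q)" for x
    using that by (auto simp: space_LB)
  have Tsp: "T x \<in> space (LB q)" if "x \<in> space (LB q)" for x
    using that by (rule measurable_space[OF T])
  have "(\<integral>\<^sup>+x. F (T x) \<partial>LB q) = (\<integral>\<^sup>+x. F (T x) * (\<integral>\<^sup>+y. gdens q y \<partial>LB q) \<partial>LB q)"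
    by (simp only: gdens_int mult_1_right)
  also have "\<dots> = (\<integral>\<^sup>+x. (\<integral>\<^sup>+y. F (T x) * gdens q y \<partial>LB q) \<partial>LB q)"
    by (intro nn_integral_cong nn_integral_cmult[symmetric] gdens_meas)
  also have "\<dots> = (\<integral>\<^sup>+y. (\<integral>\<^sup>+x. F (T x) * gdens q y \<partial>LB q) \<partial>LB q)"
    by (rule LL.Fubini'[symmetric]) measurable
  also have "\<dots> = (\<integral>\<^sup>+y. (\<integral>\<^sup>+x. F (\<lambda>i\<in>{1..q}. T x i + y i) * gdens q y \<partial>LB q) \<partial>LB q)"
  proof (rule nn_integral_cong)
    fix y assume y: "y \<in> space (LB q)"
    obtain z where z: "z \<in> space (LB q)" "T z = y" using surj[OF y] by auto
    have "(\<integral>\<^sup>+x. F (T x) * gdens q y \<partial>LB q)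
        = (\<integral>\<^sup>+x. F (T (\<lambda>i\<in>{1..q}. x i + z i)) * gdens q y \<partial>LB q)"
      by (rule LB_nn_translate[OF z(1), symmetric]) measurable
    also have "\<dots> = (\<integral>\<^sup>+x. F (\<lambda>i\<in>{1..q}. T x i + y i) * gdens q y \<partial>LB q)"
      by (intro nn_integral_cong) (simp only: add[OF _ z(1)] z(2))
    finally show "(\<integral>\<^sup>+x. F (T x) * gdens q y \<partial>LB q)
        = (\<integral>\<^sup>+x. F (\<lambda>i\<in>{1..q}. T x i + y i) * gdens q y \<partial>LB q)" .
  qed
  also have "\<dots> = (\<integral>\<^sup>+x. (\<integral>\<^sup>+y. F (\<lambda>i\<in>{1..q}. T x i + y i) * gdens q y \<partial>LB q) \<partial>LB q)"
    by (rule LL.Fubini') measurable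
  also have "\<dots> = (\<integral>\<^sup>+x. (\<integral>\<^sup>+y. F y * gdens q (\<lambda>i\<in>{1..q}. y i - T x i) \<partial>LB q) \<partial>LB q)"
  proof (rule nn_integral_cong)
    fix x assume x: "x \<in> space (LB q)"
    define a where "a = (\<lambda>i\<in>{1..q}. - T x i)"
    have a: "a \<in> space (LB q)" by (auto simp: a_def space_LB)
    have Tx: "T x \<in> space (LB q)" by (rule Tsp[OF x])
    have "(\<integral>\<^sup>+y. F (\<lambda>i\<in>{1..q}. T x i + y i) * gdens q y \<partial>LB q)
      = (\<integral>\<^sup>+y. F (\<lambda>i\<in>{1..q}. T x i + (\<lambda>i\<in>{1..q}. y i + a i) i)
           * gdens q (\<lambda>i\<in>{1..q}. y i + a i) \<partial>LB q)"
      by (rule LB_nn_translate[OF a, symmetric]) measurable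
    also have "\<dots> = (\<integral>\<^sup>+y. F y * gdens q (\<lambda>i\<in>{1..q}. y i - T x i) \<partial>LB q)"
    proof (intro nn_integral_cong)
      fix y assume y: "y \<in> space (LB q)"
      have "(\<lambda>i\<in>{1..q}. T x i + (\<lambda>i\<in>{1..q}. y i + a i) i) = (\<lambda>i\<in>{1..q}. y i)"
        by (rule restrict_ext) (simp add: a_def)
      moreover have "(\<lambda>i\<in>{1..q}. y i + a i) = (\<lambda>i\<in>{1..q}. y i - T x i)"
        by (rule restrict_ext) (simp add: a_def)
      ultimately show "F (\<lambda>i\<in>{1..q}. T x i + (\<lambda>i\<in>{1..q}. y i + a i) i)
           * gdens q (\<lambda>i\<in>{1..q}. y i + a i) = F y * gdens q (\<lambda>i\<in>{1..q}. y i - T x i)"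
        by (simp only: ext[OF y])
    qed
    finally show "(\<integral>\<^sup>+y. F (\<lambda>i\<in>{1..q}. T x i + y i) * gdens q y \<partial>LB q)
       = (\<integral>\<^sup>+y. F y * gdens q (\<lambda>i\<in>{1..q}. y i - T x i) \<partial>LB q)" .
  qed
  also have "\<dots> = (\<integral>\<^sup>+y. (\<integral>\<^sup>+x. F y * gdens q (\<lambda>i\<in>{1..q}. y i - T x i) \<partial>LB q) \<partial>LB q)"
    by (rule LL.Fubini'[symmetric]) measurable
  also have "\<dots> = (\<integral>\<^sup>+y. F y \<partial>LB q)"
  proof (rule nn_integral_cong)
    fix y assume y: "y \<in> space (LB q)"
    obtain z where z: "z \<in> space (LB q)" "T z = y" using surj[OF y] by auto
    have "(\<integral>\<^sup>+x. F y * gdens q (\<lambda>i\<in>{1..q}. y i - T x i) \<partial>LB q)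
        = (\<integral>\<^sup>+x. F y * gdens q (\<lambda>i\<in>{1..q}. y i - T (\<lambda>i\<in>{1..q}. x i + z i) i) \<partial>LB q)"
      using y by (intro LB_nn_translate[OF z(1), symmetric]) measurable
    also have "\<dots> = (\<integral>\<^sup>+x. F y * gdens q x \<partial>LB q)"
    proof (rule nn_integral_cong)
      fix x assume x: "x \<in> space (LB q)"
      have "gdens q (\<lambda>i\<in>{1..q}. y i - T (\<lambda>i\<in>{1..q}. x i + z i) i) = gdens q (\<lambda>i\<in>{1..q}. - T x i)"
        using x z by (intro arg_cong[where f="gdens q"] restrict_ext) (simp add: add[OF x z(1)] del: One_nat_def)
      also have "\<dots> = gdens q (T x)"
        by (simp add: gdens_norm dotp_def)
      also have "\<dots> = gdens q x" using nrm[OF x] by (simp add: gdens_norm)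
      finally show "F y * gdens q (\<lambda>i\<in>{1..q}. y i - T (\<lambda>i\<in>{1..q}. x i + z i) i) = F y * gdens q x"
        by simp
    qed
    also have "\<dots> = F y" by (subst nn_integral_cmult) (auto simp: gdens_int)
    finally show "(\<integral>\<^sup>+x. F y * gdens q (\<lambda>i\<in>{1..q}. y i - T x i) \<partial>LB q) = F y" .
  qed
  finally show ?thesis .
qed

abbreviation gauss :: "nat \<Rightarrow> (nat \<Rightarrow> real) measure" where
  "gauss q \<equiv> PiM {1..q} (\<lambda>_. density lborel std_normal_density)"

lemma gauss_density: "gauss q = density (LB q) (gdens q)"
proof (rule sym, rule product_sigma_finite.PiM_eqI)
  show "product_sigma_finite (\<lambda>_. density lborel (\<lambda>x. ennreal (std_normal_density x)))"
    unfolding product_sigma_finite_def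
    by (intro allI prob_space_imp_sigma_finite prob_space_normal_density) simp
  show "sets (density (LB q) (gdens q)) = sets (gauss q)"
    unfolding LB_def by (simp, intro sets_PiM_cong) auto
  fix A :: "nat \<Rightarrow> real set"
  assume A: "\<And>i. i \<in> {1..q} \<Longrightarrow> A i \<in> sets (density lborel (\<lambda>x. ennreal (std_normal_density x)))"
  have A': "A i \<in> sets borel" if "i \<in> {1..q}" for i using A[OF that] by simp
  have box: "Pi\<^sub>E {1..q} A \<in> sets (LB q)" using A' unfolding LB_def by (intro sets_PiM_I_finite) auto
  have "emeasure (density (LB q) (gdens q)) (Pi\<^sub>E {1..q} A)
      = (\<integral>\<^sup>+x. gdens q x * indicator (Pi\<^sub>E {1..q} A) x \<partial>LB q)"
    using box by (intro emeasure_density gdens_meas)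
  also have "\<dots> = (\<integral>\<^sup>+x. (\<Prod>i\<in>{1..q}. ennreal (std_normal_density (x i)) * indicator (A i) (x i)) \<partial>LB q)"
  proof (rule nn_integral_cong)
    fix x assume x: "x \<in> space (LB q)"
    have "(indicator (Pi\<^sub>E {1..q} A) x :: ennreal) = (\<Prod>i\<in>{1..q}. indicator (A i) (x i))"
    proof (cases "x \<in> Pi\<^sub>E {1..q} A")
      case True then show ?thesis by (auto simp: PiE_iff intro!: prod.neutral[symmetric])
    next
      case False
      then obtain i where "i \<in> {1..q}" "x i \<notin> A i" using x by (auto simp: space_LB PiE_iff)
      then have "(\<Prod>i\<in>{1..q}. indicator (A i) (x i) :: ennreal) = 0"
        by (intro prod_zero bexI[of _ i]) auto
      with False show ?thesis by simp
    qed
    then show "gdens q x * indicator (Pi\<^sub>E {1..q} A) x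
       = (\<Prod>i\<in>{1..q}. ennreal (std_normal_density (x i)) * indicator (A i) (x i))"
      unfolding gdens_def prod.distrib by simp
  qed
  also have "\<dots> = (\<Prod>i\<in>{1..q}. (\<integral>\<^sup>+x. ennreal (std_normal_density x) * indicator (A i) x \<partial>lborel))"
    using A' unfolding LB_def by (intro lbp.product_nn_integral_prod) auto
  also have "\<dots> = (\<Prod>i\<in>{1..q}. emeasure (density lborel std_normal_density) (A i))"
    using A' by (intro prod.cong refl, subst emeasure_density) auto
  finally show "emeasure (density (LB q) (gdens q)) (Pi\<^sub>E {1..q} A)
     = (\<Prod>i\<in>{1..q}. emeasure (density lborel std_normal_density) (A i))" .
qed simp

lemma gauss_prob: "prob_space (gauss q)"
  by (intro prob_space_PiM prob_space_normal_density) simp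

lemma gauss_isom_invariant:
  assumes "T \<in> measurable (LB q) (LB q)"
    and "\<And>x y. x \<in> space (LB q) \<Longrightarrow> y \<in> space (LB q) \<Longrightarrow>
      T (\<lambda>i\<in>{1..q}. x i + y i) = (\<lambda>i\<in>{1..q}. T x i + T y i)"
    and nrm: "\<And>x. x \<in> space (LB q) \<Longrightarrow> dotp q (T x) (T x) = dotp q x x"
    and "\<And>y. y \<in> space (LB q) \<Longrightarrow> \<exists>x\<in>space (LB q). T x = y"
    and F [measurable]: "F \<in> borel_measurable (LB q)"
  shows "(\<integral>\<^sup>+x. F (T x) \<partial>gauss q) = (\<integral>\<^sup>+x. F x \<partial>gauss q)"
proof -
  note [measurable] = assms(1)
  have "(\<integral>\<^sup>+x. F (T x) \<partial>gauss q) = (\<integral>\<^sup>+x. gdens q x * F (T x) \<partial>LB q)"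
    unfolding gauss_density by (rule nn_integral_density) measurable
  also have "\<dots> = (\<integral>\<^sup>+x. gdens q (T x) * F (T x) \<partial>LB q)"
    by (intro nn_integral_cong) (simp add: gdens_norm nrm)
  also have "\<dots> = (\<integral>\<^sup>+x. gdens q x * F x \<partial>LB q)"
    by (rule LB_isom_invariant[where F="\<lambda>x. gdens q x * F x", OF assms(1-4)]) measurable
  also have "\<dots> = (\<integral>\<^sup>+x. F x \<partial>gauss q)"
    unfolding gauss_density by (rule nn_integral_density[symmetric]) measurable
  finally show ?thesis .
qed


subsection \<open>Linear isometries of the hyperplane\<close>

lemma hyper_iff: "v \<in> hyper q \<longleftrightarrow> (\<forall>i. i \<notin> {1..q} \<longrightarrow> v i = 0) \<and> (\<Sum>i=1..q. v i) = 0"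
proof -
  have "dotp q v (evec q) = (\<Sum>i=1..q. v i)"
    unfolding dotp_def evec_def by (rule sum.cong) auto
  then show ?thesis by (simp add: hyper_def Rvec_def)
qed

lemma enorm_sq: "(enorm q v)\<^sup>2 = dotp q v v"
  by (simp add: L2_set_def dotp_def power2_eq_square sum_nonneg)

lemma proj_in_hyper: "proj q x \<in> hyper q"
proof (cases "q = 0")
  case False
  then show ?thesis
    unfolding hyper_iff proj_def by (auto simp: sum_subtractf)
qed (auto simp: hyper_iff proj_def)

lemma proj_hyper: "v \<in> hyper q \<Longrightarrow> proj q v = v"
  unfolding hyper_iff proj_def by (auto simp: fun_eq_iff)

lemma hyper_add: "v \<in> hyper q \<Longrightarrow> w \<in> hyper q \<Longrightarrow> (\<lambda>i. v i + w i) \<in> hyper q"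
  by (auto simp: hyper_iff sum.distrib)

lemma hyper_scale: "v \<in> hyper q \<Longrightarrow> (\<lambda>i. c * v i) \<in> hyper q"
  by (auto simp: hyper_iff simp flip: sum_distrib_left)

lemma hyper_sum:
  "finite J \<Longrightarrow> (\<And>j. j \<in> J \<Longrightarrow> w j \<in> hyper q) \<Longrightarrow> (\<lambda>i. \<Sum>j\<in>J. a j * w j i) \<in> hyper q"
  by (induction J rule: finite_induct) (auto intro!: hyper_add hyper_scale simp: hyper_iff[of "\<lambda>_. 0"])

lemma lin_isomD:
  assumes "lin_isom q f"
  shows "v \<in> hyper q \<Longrightarrow> f v \<in> hyper q"
    and "v \<in> hyper q \<Longrightarrow> w \<in> hyper q \<Longrightarrow> f (\<lambda>i. v i + w i) = (\<lambda>i. f v i + f w i)"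
    and "v \<in> hyper q \<Longrightarrow> f (\<lambda>i. c * v i) = (\<lambda>i. c * f v i)"
    and "v \<in> hyper q \<Longrightarrow> enorm q (f v) = enorm q v"
    and "v \<in> hyper q \<Longrightarrow> dotp q (f v) (f v) = dotp q v v"
    and "v \<in> hyper q \<Longrightarrow> \<exists>u\<in>hyper q. f u = v"
  using assms unfolding lin_isom_def by (auto simp flip: enorm_sq simp del: One_nat_def) (metis imageE)

lemma lin_isom_sum:
  assumes f: "lin_isom q f" and "finite J" "\<And>j. j \<in> J \<Longrightarrow> w j \<in> hyper q"
  shows "f (\<lambda>i. \<Sum>j\<in>J. a j * w j i) = (\<lambda>i. \<Sum>j\<in>J. a j * f (w j) i)"
  using assms(2,3)
proof (induction J rule: finite_induct)
  case empty
  have "(\<lambda>_. 0) \<in> hyper q" by (simp add: hyper_iff)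
  from lin_isomD(3)[OF f this, of 0] show ?case by simp
next
  case (insert j J)
  have "f (\<lambda>i. a j * w j i + (\<Sum>j\<in>J. a j * w j i))
      = (\<lambda>i. f (\<lambda>i. a j * w j i) i + f (\<lambda>i. \<Sum>j\<in>J. a j * w j i) i)"
    using insert by (intro lin_isomD(2)[OF f] hyper_scale hyper_sum) auto
  then show ?case using insert by (simp add: lin_isomD(3)[OF f])
qed

definition bvec :: "nat \<Rightarrow> nat \<Rightarrow> real" where
  "bvec j = (\<lambda>i. if i = j then 1 else 0)"

lemma hyper_expand:
  assumes "v \<in> hyper q"
  shows "v = (\<lambda>i. \<Sum>j=1..q. v j * proj q (bvec j) i)"
proof
  fix i
  show "v i = (\<Sum>j=1..q. v j * proj q (bvec j) i)"
  proof (cases "i \<in> {1..q}")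
    case True
    have *: "proj q (bvec j) i = (if i = j then 1 else 0) - 1 / real q" if "j \<in> {1..q}" for j
      using that True by (auto simp: proj_def bvec_def)
    have "(\<Sum>j=1..q. v j * proj q (bvec j) i)
        = (\<Sum>j=1..q. v j * (if i = j then 1 else 0) - v j / real q)"
      by (intro sum.cong refl) (simp add: * right_diff_distrib del: One_nat_def)
    also have "\<dots> = v i - (\<Sum>j=1..q. v j) / real q"
      using True by (simp add: sum_subtractf sum_divide_distrib if_distrib[where f="\<lambda>x. _ * x"] cong: if_cong)
    also have "\<dots> = v i" using assms by (simp add: hyper_iff)
    finally show ?thesis by simp
  next
    case False
    then show ?thesis using assms by (auto simp: hyper_iff proj_def)
  qed
qed

lemma lin_isom_coord:
  assumes f: "lin_isom q f" and v: "v \<in> hyper q"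
  shows "f v i = (\<Sum>j=1..q. v j * f (proj q (bvec j)) i)"
proof -
  have "f v = f (\<lambda>i. \<Sum>j=1..q. v j * proj q (bvec j) i)"
    using hyper_expand[OF v] by simp
  also have "\<dots> = (\<lambda>i. \<Sum>j=1..q. v j * f (proj q (bvec j)) i)"
    by (rule lin_isom_sum[OF f]) (auto intro: proj_in_hyper)
  finally show ?thesis by simp
qed

lemma borel_fun_measurableI:
  assumes "\<And>i. (\<lambda>x. f x i) \<in> borel_measurable M"
  shows "(f :: _ \<Rightarrow> nat \<Rightarrow> real) \<in> borel_measurable M"
  using assms by (rule measurable_coordinatewise_then_product)

lemma coord_measurable [measurable]: "(\<lambda>x :: nat \<Rightarrow> real. x i) \<in> borel_measurable borel"
  by (rule measurable_product_coordinates)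

lemma dotp_expand_mean:
  assumes v: "v \<in> hyper q" and x: "\<And>i. i \<in> {1..q} \<Longrightarrow> x i = v i + m"
  shows "dotp q x x = dotp q v v + real q * m\<^sup>2"
proof -
  have "dotp q x x = (\<Sum>i=1..q. v i * v i + 2 * m * v i + m\<^sup>2)"
    unfolding dotp_def by (intro sum.cong refl) (simp add: x algebra_simps power2_eq_square del: One_nat_def)
  also have "\<dots> = dotp q v v + 2 * m * (\<Sum>i=1..q. v i) + real q * m\<^sup>2"
    by (simp add: sum.distrib dotp_def sum_distrib_left)
  finally show ?thesis using v by (simp add: hyper_iff)
qed

definition mean :: "nat \<Rightarrow> (nat \<Rightarrow> real) \<Rightarrow> real" where
  "mean q x = (\<Sum>j=1..q. x j) / real q"

definition lift_isom :: "nat \<Rightarrow> ((nat \<Rightarrow> real) \<Rightarrow> nat \<Rightarrow> real) \<Rightarrow> (nat \<Rightarrow> real) \<Rightarrow> nat \<Rightarrow> real" where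
  "lift_isom q f x = (\<lambda>i\<in>{1..q}. f (proj q x) i + mean q x)"

lemma proj_mean: "i \<in> {1..q} \<Longrightarrow> x i = proj q x i + mean q x"
  by (simp add: proj_def mean_def)

lemma mean_eq:
  assumes "q \<ge> 1" "v \<in> hyper q" "\<And>i. i \<in> {1..q} \<Longrightarrow> x i = v i + m"
  shows "mean q x = m" "proj q x = v"
proof -
  have "(\<Sum>j=1..q. x j) = (\<Sum>j=1..q. v j + m)" by (rule sum.cong) (auto simp: assms(3))
  also have "\<dots> = real q * m" using assms(2) by (simp add: sum.distrib hyper_iff)
  finally show m: "mean q x = m" using assms(1) by (simp add: mean_def)
  show "proj q x = v"
  proof
    fix i show "proj q x i = v i"
    proof (cases "i \<in> {1..q}")
      case True then show ?thesis using proj_mean[OF True, of x] assms(3)[OF True] m by simp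
    next
      case False then show ?thesis using assms(2) by (auto simp: proj_def hyper_iff)
    qed
  qed
qed

lemma LB_sum_measurable [measurable]: "(\<lambda>x. sum x {1..q}) \<in> borel_measurable (LB q)"
  by (intro borel_measurable_sum LB_coord)

lemma proj_coord_measurable [measurable]: "(\<lambda>x. proj q x i) \<in> borel_measurable (LB q)"
proof (cases "i \<in> {1..q}")
  case True
  note [measurable] = LB_coord[OF True]
  have "(\<lambda>x. x i - (\<Sum>j=1..q. x j) / real q) \<in> borel_measurable (LB q)"
    by (intro borel_measurable_diff borel_measurable_divide LB_sum_measurable LB_coord[OF True]) simp
  then show ?thesis using True by (simp add: proj_def del: One_nat_def)
next
  case False
  then have "(\<lambda>x. proj q x i) = (\<lambda>x. 0)" by (auto simp: proj_def)
  then show ?thesis by simp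
qed

lemma mean_measurable [measurable]: "(\<lambda>x. mean q x) \<in> borel_measurable (LB q)"
  unfolding mean_def by (intro borel_measurable_divide LB_sum_measurable) simp

lemma lift_isom_props:
  assumes f: "lin_isom q f" and q: "q \<ge> 1"
  shows "lift_isom q f \<in> measurable (LB q) (LB q)"
    and "\<And>x y. lift_isom q f (\<lambda>i\<in>{1..q}. x i + y i)
           = (\<lambda>i\<in>{1..q}. lift_isom q f x i + lift_isom q f y i)"
    and "\<And>x. dotp q (lift_isom q f x) (lift_isom q f x) = dotp q x x"
    and "\<And>y. y \<in> space (LB q) \<Longrightarrow> \<exists>x\<in>space (LB q). lift_isom q f x = y"
    and "\<And>x. proj q (lift_isom q f x) = f (proj q x)"
proof -
  have "(\<lambda>x. f (proj q x) i) \<in> borel_measurable (LB q)" for i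
    by (subst lin_isom_coord[OF f proj_in_hyper]) measurable
  then show "lift_isom q f \<in> measurable (LB q) (LB q)"
    unfolding lift_isom_def by measurable
  fix x y :: "nat \<Rightarrow> real"
  have 1: "(\<lambda>i\<in>{1..q}. x i + y i) i = (proj q x i + proj q y i) + (mean q x + mean q y)"
    if "i \<in> {1..q}" for i using proj_mean[OF that, of x] proj_mean[OF that, of y] that by simp
  note m = mean_eq[where x="\<lambda>i\<in>{1..q}. x i + y i", OF q hyper_add[OF proj_in_hyper proj_in_hyper] 1]
  show "lift_isom q f (\<lambda>i\<in>{1..q}. x i + y i)
           = (\<lambda>i\<in>{1..q}. lift_isom q f x i + lift_isom q f y i)"
    unfolding lift_isom_def
    by (rule restrict_ext) (simp only: m, simp add: lin_isomD(2)[OF f proj_in_hyper proj_in_hyper] del: One_nat_def)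
  have 2: "lift_isom q f x i = f (proj q x) i + mean q x" if "i \<in> {1..q}" for i
    using that by (simp add: lift_isom_def)
  have fp: "f (proj q x) \<in> hyper q" by (rule lin_isomD(1)[OF f proj_in_hyper])
  show "proj q (lift_isom q f x) = f (proj q x)"
    by (rule mean_eq(2)[OF q fp 2])
  have "dotp q (lift_isom q f x) (lift_isom q f x) = dotp q (f (proj q x)) (f (proj q x)) + real q * (mean q x)\<^sup>2"
    by (rule dotp_expand_mean[OF fp 2])
  also have "\<dots> = dotp q (proj q x) (proj q x) + real q * (mean q x)\<^sup>2"
    by (simp add: lin_isomD(5)[OF f proj_in_hyper])
  also have "\<dots> = dotp q x x"
    by (rule dotp_expand_mean[OF proj_in_hyper proj_mean, symmetric])
  finally show "dotp q (lift_isom q f x) (lift_isom q f x) = dotp q x x" .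
  assume y: "y \<in> space (LB q)"
  obtain u where u: "u \<in> hyper q" "f u = proj q y"
    using lin_isomD(6)[OF f proj_in_hyper] by blast
  define z where "z = (\<lambda>i\<in>{1..q}. u i + mean q y)"
  have 3: "z i = u i + mean q y" if "i \<in> {1..q}" for i using that by (simp add: z_def)
  have "lift_isom q f z = (\<lambda>i\<in>{1..q}. proj q y i + mean q y)"
    unfolding lift_isom_def
    by (simp only: mean_eq[where x=z and v=u and m="mean q y", OF q u(1) 3] u(2))
  also have "\<dots> = (\<lambda>i\<in>{1..q}. y i)"
    by (rule restrict_ext) (simp add: proj_mean[symmetric] del: One_nat_def)
  also have "\<dots> = y" using y unfolding space_LB by auto
  finally show "\<exists>x\<in>space (LB q). lift_isom q f x = y"
    by (intro bexI[of _ z]) (auto simp: space_LB z_def)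
qed


subsection \<open>Existence of the uniform distribution\<close>

lemma sphere_nonempty:
  assumes "q \<ge> 2" "\<rho> > 0"
  shows "sphere_hyper q \<rho> \<noteq> {}"
proof -
  define v :: "nat \<Rightarrow> real" where "v = (\<lambda>i. if i = 1 then \<rho> / sqrt 2 else if i = 2 then - \<rho> / sqrt 2 else 0)"
  have E: "{1..q} = insert 1 (insert 2 {3..q})" using assms by auto
  have z: "(\<Sum>i=3..q. v i) = 0" "(\<Sum>i=3..q. (v i)\<^sup>2) = 0"
    by (rule sum.neutral, simp add: v_def)+
  have "v \<in> hyper q"
    unfolding hyper_iff E using assms z by (auto simp: v_def)
  moreover have "enorm q v = \<rho>"
    unfolding L2_set_def E using assms z by (simp add: v_def power_divide)
  ultimately show ?thesis by (auto simp: sphere_hyper_def)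
qed

text \<open>
  The normalized projection of a standard Gaussian vector; the fallback value is used only on a
  null set.
\<close>

definition ndir :: "nat \<Rightarrow> real \<Rightarrow> (nat \<Rightarrow> real) \<Rightarrow> nat \<Rightarrow> real" where
  "ndir q \<rho> x = (if enorm q (proj q x) = 0 then (SOME v. v \<in> sphere_hyper q \<rho>)
     else (\<lambda>i. \<rho> / enorm q (proj q x) * proj q x i))"

lemma enorm_scale: "enorm q (\<lambda>i. c * v i) = \<bar>c\<bar> * enorm q v"
  by (simp add: L2_set_def power_mult_distrib real_sqrt_mult flip: sum_distrib_left)

lemma ndir_sphere:
  assumes "q \<ge> 2" "\<rho> > 0" shows "ndir q \<rho> x \<in> sphere_hyper q \<rho>"
proof (cases "enorm q (proj q x) = 0")
  case True
  then show ?thesis using sphere_nonempty[OF assms] by (simp add: ndir_def some_in_eq)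
next
  case False
  then show ?thesis using assms
    unfolding ndir_def sphere_hyper_def
    by (simp add: enorm_scale hyper_scale proj_in_hyper del: One_nat_def times_divide_eq_left) simp
qed

abbreviation SB :: "nat \<Rightarrow> real \<Rightarrow> (nat \<Rightarrow> real) measure" where
  "SB q \<rho> \<equiv> restrict_space borel (sphere_hyper q \<rho>)"

lemma space_SB: "space (SB q \<rho>) = sphere_hyper q \<rho>"
  by (simp add: space_restrict_space)

lemma ndir_measurable [measurable]:
  assumes "q \<ge> 2" "\<rho> > 0" shows "ndir q \<rho> \<in> measurable (LB q) (SB q \<rho>)"
proof (rule measurable_restrict_space2)
  show "ndir q \<rho> \<in> borel_measurable (LB q)"
    unfolding ndir_def L2_set_def
    by (rule borel_fun_measurableI) (unfold if_distrib[where f="\<lambda>x. x _"], measurable)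
qed (use ndir_sphere[OF assms] in auto)

lemma lin_isom_measurable:
  assumes "lin_isom q f" shows "f \<in> measurable (SB q \<rho>) (SB q \<rho>)"
proof (rule measurable_restrict_space2)
  show "f \<in> borel_measurable (SB q \<rho>)"
  proof (rule borel_fun_measurableI)
    fix i
    have "(\<lambda>v. \<Sum>j=1..q. v j * f (proj q (bvec j)) i) \<in> borel_measurable (SB q \<rho>)"
      by (rule measurable_restrict_space1) measurable
    then show "(\<lambda>v. f v i) \<in> borel_measurable (SB q \<rho>)"
      by (rule measurable_cong[THEN iffD2, rotated])
        (rule lin_isom_coord[OF assms], unfold space_SB, simp add: sphere_hyper_def)
  qed
qed (use lin_isomD[OF assms] in \<open>unfold space_SB, auto simp: sphere_hyper_def\<close>)

lemma LB_AE_nonconst: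
  assumes q: "q \<ge> 2" shows "AE x in LB q. enorm q (proj q x) \<noteq> 0"
proof -
  have E: "{1..q} = insert 1 {2..q}" using q by auto
  have [measurable]: "(\<lambda>x. x 1) \<in> borel_measurable (LB q)" "(\<lambda>x. x 2) \<in> borel_measurable (LB q)"
    using q by (auto intro!: LB_coord simp del: One_nat_def)
  have S: "{x \<in> space (LB q). x 1 = x 2} \<in> sets (LB q)"
    by measurable
  have "emeasure (LB q) {x \<in> space (LB q). x 1 = x 2}
     = (\<integral>\<^sup>+x. indicator {x \<in> space (LB q). x 1 = x 2} x \<partial>LB q)"
    using S by simp
  also have "\<dots> = (\<integral>\<^sup>+x. (if x 1 = x 2 then 1 else 0) \<partial>LB q)"
    by (rule nn_integral_cong) (auto simp: indicator_def)
  also have "\<dots> = (\<integral>\<^sup>+x. (\<integral>\<^sup>+y. (if (x(1 := y)) 1 = (x(1 := y)) 2 then 1 else 0) \<partial>(lborel :: real measure)) \<partial>PiM {2..q} (\<lambda>_. lborel))"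
  proof -
    have "(\<lambda>x. if x 1 = x 2 then 1 else 0 :: ennreal) \<in> borel_measurable (LB q)" by measurable
    then show ?thesis
      unfolding LB_def E by (subst lbp.product_nn_integral_insert) auto
  qed
  also have "\<dots> = (\<integral>\<^sup>+x. (\<integral>\<^sup>+y. indicator {x 2} y \<partial>(lborel :: real measure)) \<partial>PiM {2..q} (\<lambda>_. lborel))"
    by (intro nn_integral_cong) (auto simp: indicator_def)
  also have "\<dots> = 0" by simp
  finally have "AE x in LB q. x 1 \<noteq> x 2"
    by (intro AE_I[OF _ _ S]) auto
  then show ?thesis
  proof eventually_elim
    case (elim x)
    have "proj q x 1 \<noteq> proj q x 2" using elim q by (simp add: proj_def)
    then have "\<exists>i\<in>{1..q}. proj q x i \<noteq> 0"
      using q by (cases "proj q x 1 = 0") (auto intro: bexI[of _ 1] bexI[of _ 2])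
    then show ?case by (simp add: L2_set_eq_0_iff del: One_nat_def)
  qed
qed

definition unif_gauss :: "nat \<Rightarrow> real \<Rightarrow> (nat \<Rightarrow> real) measure" where
  "unif_gauss q \<rho> = distr (gauss q) (SB q \<rho>) (ndir q \<rho>)"

lemma sets_gauss: "sets (gauss q) = sets (LB q)"
  unfolding LB_def by (intro sets_PiM_cong) auto

lemma unif_gauss_invariant:
  assumes q: "q \<ge> 2" and \<rho>: "\<rho> > 0" shows "rot_invariant_prob q \<rho> (unif_gauss q \<rho>)"
  unfolding rot_invariant_prob_def
proof (intro conjI allI impI)
  note [measurable] = ndir_measurable[OF q \<rho>]
  have nm [measurable]: "ndir q \<rho> \<in> measurable (gauss q) (SB q \<rho>)"
    using ndir_measurable[OF q \<rho>] by (simp only: measurable_cong_sets[OF sets_gauss refl])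
  show "prob_space (unif_gauss q \<rho>)"
    unfolding unif_gauss_def by (intro prob_space.prob_space_distr gauss_prob nm)
  show s: "sets (unif_gauss q \<rho>) = sets (SB q \<rho>)" by (simp add: unif_gauss_def)
  fix f assume f: "lin_isom q f"
  note [measurable] = lin_isom_measurable[OF f]
  note L = lift_isom_props[OF f order_trans[OF one_le_numeral q]]
  note [measurable] = L(1)
  show "distr (unif_gauss q \<rho>) (unif_gauss q \<rho>) f = unif_gauss q \<rho>"
  proof (rule measure_eqI)
    fix A assume "A \<in> sets (distr (unif_gauss q \<rho>) (unif_gauss q \<rho>) f)"
    then have A [measurable]: "A \<in> sets (SB q \<rho>)" by (simp add: s)
    have *: "(\<integral>\<^sup>+x. indicator A (g x) \<partial>gauss q) = emeasure (distr (gauss q) (SB q \<rho>) g) A"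
      if [measurable]: "g \<in> measurable (gauss q) (SB q \<rho>)" for g
    proof -
      have "emeasure (distr (gauss q) (SB q \<rho>) g) A = (\<integral>\<^sup>+x. indicator A x \<partial>distr (gauss q) (SB q \<rho>) g)"
        by simp
      also have "\<dots> = (\<integral>\<^sup>+x. indicator A (g x) \<partial>gauss q)" by (rule nn_integral_distr) measurable
      finally show ?thesis by simp
    qed
    have "distr (unif_gauss q \<rho>) (unif_gauss q \<rho>) f = distr (distr (gauss q) (SB q \<rho>) (ndir q \<rho>)) (SB q \<rho>) f"
      by (rule distr_cong) (auto simp: unif_gauss_def)
    also have "\<dots> = distr (gauss q) (SB q \<rho>) (f \<circ> ndir q \<rho>)"
      by (rule distr_distr) measurable
    finally have "emeasure (distr (unif_gauss q \<rho>) (unif_gauss q \<rho>) f) A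
        = (\<integral>\<^sup>+x. indicator A (f (ndir q \<rho> x)) \<partial>gauss q)"
      using *[OF measurable_compose[OF nm lin_isom_measurable[OF f]]] by (simp add: comp_def)
    also have "\<dots> = (\<integral>\<^sup>+x. indicator A (ndir q \<rho> (lift_isom q f x)) \<partial>gauss q)"
    proof (rule nn_integral_cong_AE)
      have "AE x in gauss q. enorm q (proj q x) \<noteq> 0"
        unfolding gauss_density by (subst AE_density) (use LB_AE_nonconst[OF q] in auto)
      then show "AE x in gauss q. (indicator A (f (ndir q \<rho> x)) :: ennreal)
          = indicator A (ndir q \<rho> (lift_isom q f x))"
      proof eventually_elim
        case (elim x)
        have "f (ndir q \<rho> x) = ndir q \<rho> (lift_isom q f x)"
          using elim unfolding ndir_def L(5) lin_isomD(4)[OF f proj_in_hyper]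
          by (simp only: if_False lin_isomD(3)[OF f proj_in_hyper])
        then show ?case by simp
      qed
    qed
    also have "\<dots> = (\<integral>\<^sup>+x. indicator A (ndir q \<rho> x) \<partial>gauss q)"
      by (rule gauss_isom_invariant[where F="\<lambda>x. indicator A (ndir q \<rho> x)", OF L(1-4)]) measurable
    also have "\<dots> = emeasure (unif_gauss q \<rho>) A"
      unfolding unif_gauss_def by (rule *[OF nm])
    finally show "emeasure (distr (unif_gauss q \<rho>) (unif_gauss q \<rho>) f) A = emeasure (unif_gauss q \<rho>) A" .
  qed simp
qed


subsection \<open>Uniqueness of the uniform distribution\<close>

definition ed :: "nat \<Rightarrow> (nat \<Rightarrow> real) \<Rightarrow> (nat \<Rightarrow> real) \<Rightarrow> real" where
  "ed q x y = enorm q (\<lambda>i. y i - x i)"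

definition hh :: "nat \<Rightarrow> (nat \<Rightarrow> real) \<Rightarrow> (nat \<Rightarrow> real) \<Rightarrow> nat \<Rightarrow> real" where
  "hh q w x = (\<lambda>i. x i + (- 2 * dotp q x w / dotp q w w) * w i)"

lemma dotp_add: "dotp q (\<lambda>i. x i + c * w i) z = dotp q x z + c * dotp q w z"
  by (simp add: dotp_def sum_distrib_left sum.distrib algebra_simps)

lemma dotp_scale: "dotp q (\<lambda>i. c * w i) z = c * dotp q w z"
  by (simp add: dotp_def sum_distrib_left algebra_simps)

lemma dotp_commute: "dotp q x y = dotp q y x"
  by (simp add: dotp_def mult.commute)

lemma enorm_eq_iff: "enorm q x = enorm q y \<longleftrightarrow> dotp q x x = dotp q y y"
  unfolding enorm_sq[symmetric] by (simp add: power2_eq_iff_nonneg L2_set_nonneg)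

lemma dotp_self_0: "w \<in> hyper q \<Longrightarrow> dotp q w w = 0 \<Longrightarrow> w = (\<lambda>_. 0)"
  unfolding enorm_sq[symmetric] hyper_iff fun_eq_iff by (auto simp: L2_set_eq_0_iff)

lemma hh_lin_isom:
  assumes w: "w \<in> hyper q" shows "lin_isom q (hh q w)"
proof (cases "dotp q w w = 0")
  case True
  then have "hh q w = (\<lambda>x. x)" by (auto simp: hh_def)
  then show ?thesis by (simp add: lin_isom_def)
next
  case False
  have H: "hh q w x \<in> hyper q" if "x \<in> hyper q" for x
    unfolding hh_def using that w by (intro hyper_add hyper_scale)
  have I: "hh q w (hh q w x) = x" for x
  proof -
    have "dotp q (hh q w x) w = - dotp q x w"
      unfolding hh_def dotp_add using False by (simp add: field_simps)
    then show ?thesis by (simp add: hh_def[of q w "hh q w x"]) (simp add: hh_def)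
  qed
  have N: "dotp q (hh q w x) (hh q w x) = dotp q x x" for x
  proof -
    have "dotp q (hh q w x) w = - dotp q x w"
      unfolding hh_def dotp_add using False by (simp add: field_simps)
    moreover have "dotp q (hh q w x) x = dotp q x x - 2 * (dotp q x w)\<^sup>2 / dotp q w w"
      unfolding hh_def dotp_add by (simp add: dotp_commute[of q w x] power2_eq_square)
    moreover have "dotp q (hh q w x) (hh q w x) = dotp q x (hh q w x) + (- 2 * dotp q x w / dotp q w w) * dotp q w (hh q w x)"
      by (subst hh_def) (simp only: dotp_add)
    ultimately show ?thesis
      using False by (simp add: dotp_commute[of q x "hh q w x"] dotp_commute[of q w "hh q w x"] field_simps power2_eq_square)
  qed
  show ?thesis
    unfolding lin_isom_def
  proof (intro conjI ballI allI)
    show "hh q w ` hyper q = hyper q"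
      using H I by (metis (no_types, lifting) image_eqI image_subsetI subsetI subset_antisym)
    fix v assume v: "v \<in> hyper q"
    show "enorm q (hh q w v) = enorm q v" unfolding enorm_eq_iff by (rule N)
    show "hh q w (\<lambda>i. c * v i) = (\<lambda>i. c * hh q w v i)" for c
      by (auto simp: hh_def dotp_scale algebra_simps)
    fix u assume u: "u \<in> hyper q"
    show "hh q w (\<lambda>i. v i + u i) = (\<lambda>i. hh q w v i + hh q w u i)"
      using dotp_add[of q v 1 u w] False by (auto simp: hh_def field_simps)
  qed
qed

lemma sphere_transitive:
  assumes u: "u \<in> sphere_hyper q \<rho>" and v: "v \<in> sphere_hyper q \<rho>"
  shows "\<exists>f. lin_isom q f \<and> f u = v"
proof -
  define w where "w = (\<lambda>i. u i + (-1) * v i)"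
  have uv: "u \<in> hyper q" "v \<in> hyper q" "dotp q u u = dotp q v v"
    using u v by (auto simp: sphere_hyper_def simp flip: enorm_sq)
  then have w: "w \<in> hyper q" unfolding w_def by (intro hyper_add hyper_scale)
  have 1: "dotp q u w = dotp q u u - dotp q u v"
    by (subst dotp_commute) (simp add: w_def dotp_add[where c="-1", simplified] dotp_commute[of q v u])
  have 2: "dotp q v w = dotp q u v - dotp q u u"
    by (subst dotp_commute) (simp add: w_def dotp_add[where c="-1", simplified] uv(3))
  have 3: "dotp q w w = 2 * dotp q u w"
    by (subst (1) w_def) (simp only: dotp_add 1 2, simp)
  have "hh q w u = v"
  proof (cases "dotp q w w = 0")
    case True
    then have "w = (\<lambda>_. 0)" using dotp_self_0 w by blast
    then show ?thesis by (auto simp: hh_def w_def fun_eq_iff)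
  next
    case False
    then show ?thesis using 3 by (simp add: hh_def) (simp add: w_def)
  qed
  then show ?thesis using hh_lin_isom[OF w] by blast
qed

lemma lin_isom_ed:
  assumes f: "lin_isom q f" and x: "x \<in> hyper q" and y: "y \<in> hyper q"
  shows "ed q (f x) (f y) = ed q x y"
proof -
  have "f (\<lambda>i. y i + (-1) * x i) = (\<lambda>i. f y i + (-1) * f x i)"
    using lin_isomD(2)[OF f y hyper_scale[OF x, of "-1"]] lin_isomD(3)[OF f x, of "-1"] by simp
  then show ?thesis
    using lin_isomD(4)[OF f hyper_add[OF y hyper_scale[OF x, of "-1"]]] by (simp add: ed_def)
qed

lemma ed_commute: "ed q x y = ed q y x"
  by (simp add: ed_def L2_set_def power2_commute)

definition sball :: "nat \<Rightarrow> real \<Rightarrow> (nat \<Rightarrow> real) \<Rightarrow> real \<Rightarrow> (nat \<Rightarrow> real) set" where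
  "sball q \<rho> x r = {y \<in> sphere_hyper q \<rho>. ed q x y < r}"

lemma SB_coord [measurable (raw)]:
  assumes "g \<in> measurable N (SB q \<rho>)" shows "(\<lambda>x. g x i) \<in> borel_measurable N"
  by (rule measurable_compose[OF assms measurable_restrict_space1[OF coord_measurable]])

lemma ed_measurable [measurable (raw)]:
  assumes [measurable]: "g \<in> measurable N (SB q \<rho>)" "h \<in> measurable N (SB q \<rho>)"
  shows "(\<lambda>p. ed q (g p) (h p)) \<in> borel_measurable N"
  unfolding ed_def L2_set_def by measurable

lemma ed_open: "open {y. ed q x y < r}"
  unfolding ed_def L2_set_def
  by (intro open_Collect_less continuous_intros continuous_on_product_coordinates)

lemma sball_sets [measurable]: "sball q \<rho> x r \<in> sets (SB q \<rho>)"
proof -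
  have "sball q \<rho> x r = sphere_hyper q \<rho> \<inter> {y. ed q x y < r}" by (auto simp: sball_def)
  then show ?thesis using ed_open[of q x r] by (auto simp: sets_restrict_space)
qed

lemma rotD:
  assumes "rot_invariant_prob q \<rho> U"
  shows "prob_space U" "sets U = sets (SB q \<rho>)" "space U = sphere_hyper q \<rho>"
    "lin_isom q f \<Longrightarrow> distr U U f = U"
  using assms sets_eq_imp_space_eq[of U "SB q \<rho>"]
  by (auto simp: rot_invariant_prob_def space_SB)

lemma sball_const:
  assumes U: "rot_invariant_prob q \<rho> U" and x: "x \<in> sphere_hyper q \<rho>" and y: "y \<in> sphere_hyper q \<rho>"
  shows "emeasure U (sball q \<rho> x r) = emeasure U (sball q \<rho> y r)"
proof -
  note R = rotD[OF U]
  obtain f where f: "lin_isom q f" "f x = y" using sphere_transitive[OF x y] by blast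
  have m: "f \<in> measurable U U"
    using lin_isom_measurable[OF f(1)] by (simp only: measurable_cong_sets[OF R(2) R(2)])
  have "emeasure U (sball q \<rho> y r) = emeasure (distr U U f) (sball q \<rho> y r)"
    by (simp only: R(4)[OF f(1)])
  also have "\<dots> = emeasure U (f -` sball q \<rho> y r \<inter> space U)"
    by (rule emeasure_distr[OF m]) (simp add: R(2) sball_sets)
  also have "f -` sball q \<rho> y r \<inter> space U = sball q \<rho> x r"
    using lin_isomD(1,4)[OF f(1)] lin_isom_ed[OF f(1)] x f(2)
    by (auto simp: R(3) sball_def sphere_hyper_def)
  finally show ?thesis by simp
qed

lemma rot_fubini:
  assumes U: "rot_invariant_prob q \<rho> U" and V: "rot_invariant_prob q \<rho> V"
    and B: "B \<in> sets (SB q \<rho>)"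
  shows "(\<integral>\<^sup>+x. emeasure V (B \<inter> sball q \<rho> x r) \<partial>U)
       = (\<integral>\<^sup>+y. indicator B y * emeasure U (sball q \<rho> y r) \<partial>V)"
    and "(\<lambda>x. emeasure V (B \<inter> sball q \<rho> x r)) \<in> borel_measurable U"
proof -
  interpret U: prob_space U by (rule rotD(1)[OF U])
  interpret V: prob_space V by (rule rotD(1)[OF V])
  interpret UV: pair_sigma_finite U V by standard
  note [simp, measurable_cong] = rotD(2)[OF U] rotD(2)[OF V]
  note [measurable] = B
  have 1: "emeasure V (B \<inter> sball q \<rho> x r) = (\<integral>\<^sup>+y. indicator B y * indicator {..<r} (ed q x y) \<partial>V)" for x
  proof -
    have "emeasure V (B \<inter> sball q \<rho> x r) = (\<integral>\<^sup>+y. indicator (B \<inter> sball q \<rho> x r) y \<partial>V)"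
      by simp
    also have "\<dots> = (\<integral>\<^sup>+y. indicator B y * indicator {..<r} (ed q x y) \<partial>V)"
      by (rule nn_integral_cong) (auto simp: indicator_def sball_def rotD(3)[OF V])
    finally show ?thesis .
  qed
  have 2: "indicator B y * emeasure U (sball q \<rho> y r) = (\<integral>\<^sup>+x. indicator B y * indicator {..<r} (ed q x y) \<partial>U)"
    if y: "y \<in> space V" for y
  proof -
    have [measurable]: "(\<lambda>_. y) \<in> measurable U (SB q \<rho>)"
      using y by (simp add: space_SB rotD(3)[OF V])
    have "emeasure U (sball q \<rho> y r) = (\<integral>\<^sup>+x. indicator (sball q \<rho> y r) x \<partial>U)"
      by simp
    also have "\<dots> = (\<integral>\<^sup>+x. indicator {..<r} (ed q x y) \<partial>U)"
      by (rule nn_integral_cong) (auto simp: indicator_def sball_def rotD(3)[OF U] ed_commute)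
    finally show ?thesis by (simp add: nn_integral_cmult)
  qed
  show "(\<lambda>x. emeasure V (B \<inter> sball q \<rho> x r)) \<in> borel_measurable U"
    unfolding 1 by measurable
  show "(\<integral>\<^sup>+x. emeasure V (B \<inter> sball q \<rho> x r) \<partial>U)
       = (\<integral>\<^sup>+y. indicator B y * emeasure U (sball q \<rho> y r) \<partial>V)"
  proof -
    have "(\<integral>\<^sup>+x. emeasure V (B \<inter> sball q \<rho> x r) \<partial>U)
        = (\<integral>\<^sup>+y. (\<integral>\<^sup>+x. indicator B y * indicator {..<r} (ed q x y) \<partial>U) \<partial>V)"
      unfolding 1 by (rule UV.Fubini'[symmetric]) measurable
    also have "\<dots> = (\<integral>\<^sup>+y. indicator B y * emeasure U (sball q \<rho> y r) \<partial>V)"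
      by (rule nn_integral_cong) (rule 2[symmetric])
    finally show ?thesis .
  qed
qed

lemma sball_eq:
  assumes U: "rot_invariant_prob q \<rho> U" and V: "rot_invariant_prob q \<rho> V"
    and x: "x \<in> sphere_hyper q \<rho>"
  shows "emeasure U (sball q \<rho> x r) = emeasure V (sball q \<rho> x r)"
proof -
  interpret U: prob_space U by (rule rotD(1)[OF U])
  interpret V: prob_space V by (rule rotD(1)[OF V])
  have S: "sphere_hyper q \<rho> \<in> sets (SB q \<rho>)" by (metis sets.top space_SB)
  have "emeasure V (sball q \<rho> x r) = (\<integral>\<^sup>+y. emeasure V (sphere_hyper q \<rho> \<inter> sball q \<rho> y r) \<partial>U)"
  proof -
    have "(\<integral>\<^sup>+y. emeasure V (sphere_hyper q \<rho> \<inter> sball q \<rho> y r) \<partial>U) = (\<integral>\<^sup>+y. emeasure V (sball q \<rho> x r) \<partial>U)"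
    proof (rule nn_integral_cong)
      fix y assume "y \<in> space U"
      then have "y \<in> sphere_hyper q \<rho>" by (simp add: rotD(3)[OF U])
      moreover have "sphere_hyper q \<rho> \<inter> sball q \<rho> y r = sball q \<rho> y r" by (auto simp: sball_def)
      ultimately show "emeasure V (sphere_hyper q \<rho> \<inter> sball q \<rho> y r) = emeasure V (sball q \<rho> x r)"
        using sball_const[OF V _ x] by simp
    qed
    then show ?thesis by (simp add: U.emeasure_space_1)
  qed
  also have "\<dots> = (\<integral>\<^sup>+y. indicator (sphere_hyper q \<rho>) y * emeasure U (sball q \<rho> y r) \<partial>V)"
    by (rule rot_fubini(1)[OF U V S])
  also have "\<dots> = (\<integral>\<^sup>+y. emeasure U (sball q \<rho> x r) \<partial>V)"
    by (rule nn_integral_cong) (auto simp: rotD(3)[OF V] intro: sball_const[OF U _ x])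
  finally show ?thesis by (simp add: V.emeasure_space_1)
qed

lemma sball_pos:
  assumes U: "rot_invariant_prob q \<rho> U" and x: "x \<in> sphere_hyper q \<rho>" and r: "r > 0"
  shows "emeasure U (sball q \<rho> x r) \<noteq> 0"
proof
  interpret U: prob_space U by (rule rotD(1)[OF U])
  assume 0: "emeasure U (sball q \<rho> x r) = 0"
  define F where "F = (\<lambda>y. {z. ed q y z < r}) ` sphere_hyper q \<rho>"
  obtain F' where F': "F' \<subseteq> F" "countable F'" "\<Union>F' = \<Union>F"
    by (rule Lindelof[of F]) (use ed_open in \<open>auto simp: F_def\<close>)
  have "(\<Union>C\<in>F'. C \<inter> sphere_hyper q \<rho>) \<in> null_sets U"
  proof (rule null_sets_UN'[OF F'(2)])
    fix C assume "C \<in> F'"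
    then obtain y where y: "y \<in> sphere_hyper q \<rho>" "C = {z. ed q y z < r}"
      using F'(1) by (auto simp: F_def)
    then have "C \<inter> sphere_hyper q \<rho> = sball q \<rho> y r" by (auto simp: sball_def)
    then show "C \<inter> sphere_hyper q \<rho> \<in> null_sets U"
      using sball_const[OF U x y(1), of r] 0 by (auto simp: null_sets_def rotD(2)[OF U] sball_sets)
  qed
  moreover have "(\<Union>C\<in>F'. C \<inter> sphere_hyper q \<rho>) = space U"
  proof -
    have "ed q y y = 0" for y by (simp add: ed_def L2_set_def)
    then have "sphere_hyper q \<rho> \<subseteq> \<Union>F'" unfolding F'(3) F_def using r by auto
    then show ?thesis by (auto simp: rotD(3)[OF U])
  qed
  ultimately show False using U.emeasure_space_1 by auto
qed

lemma open_sball: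
  assumes "open W" "x \<in> W" "x \<in> sphere_hyper q \<rho>"
  shows "\<exists>r>0. sball q \<rho> x r \<subseteq> W"
proof -
  obtain X where X: "x \<in> Pi\<^sub>E UNIV X" "\<And>i. open (X i)" "finite {i. X i \<noteq> UNIV}" "Pi\<^sub>E UNIV X \<subseteq> W"
    using product_topology_open_contains_basis[of "\<lambda>_. euclidean" UNIV W x] assms
    unfolding open_fun_def by auto
  define J where "J = {i. X i \<noteq> UNIV}"
  have "\<exists>e>0. \<forall>t. \<bar>t - x i\<bar> < e \<longrightarrow> t \<in> X i" for i
    using X(1) X(2)[of i] by (auto simp: open_dist dist_real_def PiE_iff)
  then obtain e where e: "\<And>i. e i > 0" "\<And>i t. \<bar>t - x i\<bar> < e i \<Longrightarrow> t \<in> X i" by metis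
  define r where "r = Min (insert 1 (e ` J))"
  have r: "r > 0" "\<And>i. i \<in> J \<Longrightarrow> r \<le> e i"
    using X(3) e(1) unfolding r_def J_def[symmetric] by auto
  have "sball q \<rho> x r \<subseteq> W"
  proof
    fix y assume y: "y \<in> sball q \<rho> x r"
    have "y i \<in> X i" for i
    proof (cases "i \<in> J")
      case True
      have "\<bar>y i - x i\<bar> < r"
      proof (cases "i \<in> {1..q}")
        case True
        then have "\<bar>y i - x i\<bar> \<le> ed q x y"
          unfolding ed_def using member_le_L2_set[of "{1..q}" i "\<lambda>i. \<bar>y i - x i\<bar>"]
          by (simp add: L2_set_def del: One_nat_def)
        then show ?thesis using y by (simp add: sball_def)
      next
        case False
        then show ?thesis using y assms(3) r(1) by (simp add: sball_def sphere_hyper_def hyper_iff del: One_nat_def)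
      qed
      then show ?thesis using e(2) r(2)[OF True] by force
    qed (simp add: J_def)
    then show "y \<in> W" using X(4) by (auto simp: PiE_iff)
  qed
  then show ?thesis using r(1) by blast
qed

lemma rot_open_le:
  assumes U: "rot_invariant_prob q \<rho> U" and V: "rot_invariant_prob q \<rho> V" and W: "open W"
  shows "emeasure U (W \<inter> sphere_hyper q \<rho>) \<le> emeasure V (W \<inter> sphere_hyper q \<rho>)"
proof -
  interpret U: prob_space U by (rule rotD(1)[OF U])
  interpret V: prob_space V by (rule rotD(1)[OF V])
  define B where "B = W \<inter> sphere_hyper q \<rho>"
  have B: "B \<in> sets (SB q \<rho>)" using W by (auto simp: B_def sets_restrict_space)
  obtain x0 where x0: "x0 \<in> sphere_hyper q \<rho>" using U.not_empty by (auto simp: rotD(3)[OF U])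
  define r where "r n = 1 / real (Suc n)" for n
  define h where "h n = emeasure V (sball q \<rho> x0 (r n))" for n
  have h: "emeasure V (sball q \<rho> x (r n)) = h n" "emeasure U (sball q \<rho> x (r n)) = h n"
    if "x \<in> sphere_hyper q \<rho>" for x n
    using sball_const[OF V that x0] sball_eq[OF U V that] by (simp_all add: h_def)
  have h0: "h n \<noteq> 0" "h n \<noteq> \<top>" for n
    unfolding h_def using sball_pos[OF V x0, of "r n"] by (auto simp: r_def)
  define G where "G n x = emeasure V (B \<inter> sball q \<rho> x (r n)) / h n" for n x
  have Gm [measurable]: "G n \<in> borel_measurable U" for n
    unfolding G_def using rot_fubini(2)[OF U V B] by (intro borel_measurable_divide_ennreal) auto
  have le: "indicator B x \<le> liminf (\<lambda>n. G n x)" if x: "x \<in> space U" for x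
  proof (cases "x \<in> B")
    case True
    then have xS: "x \<in> sphere_hyper q \<rho>" "x \<in> W" by (auto simp: B_def)
    obtain e where e: "e > 0" "sball q \<rho> x e \<subseteq> W" using open_sball[OF W xS(2,1)] by blast
    have "\<forall>\<^sub>F n in sequentially. r n < e"
      unfolding r_def using e(1) by (rule order_tendstoD(2)[OF LIMSEQ_inverse_real_of_nat[unfolded inverse_eq_divide]])
    then have "\<forall>\<^sub>F n in sequentially. G n x = 1"
    proof eventually_elim
      case (elim n)
      then have "B \<inter> sball q \<rho> x (r n) = sball q \<rho> x (r n)"
        using e(2) by (auto simp: B_def sball_def)
      then show ?case using h(1)[OF xS(1)] h0[of n] by (simp add: G_def ennreal_divide_self less_top)
    qed
    then have "liminf (\<lambda>n. G n x) = liminf (\<lambda>n. 1)" by (rule Liminf_eq)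
    then show ?thesis by (simp add: Liminf_const True)
  qed simp
  have "emeasure U B = (\<integral>\<^sup>+x. indicator B x \<partial>U)" using B by (simp add: rotD(2)[OF U])
  also have "\<dots> \<le> (\<integral>\<^sup>+x. liminf (\<lambda>n. G n x) \<partial>U)" by (intro nn_integral_mono le)
  also have "\<dots> \<le> liminf (\<lambda>n. \<integral>\<^sup>+x. G n x \<partial>U)" by (rule nn_integral_liminf) measurable
  also have "(\<lambda>n. \<integral>\<^sup>+x. G n x \<partial>U) = (\<lambda>n. emeasure V B)"
  proof
    fix n
    have "(\<integral>\<^sup>+x. G n x \<partial>U) = (\<integral>\<^sup>+x. emeasure V (B \<inter> sball q \<rho> x (r n)) \<partial>U) / h n"
      unfolding G_def by (rule nn_integral_divide) (rule rot_fubini(2)[OF U V B])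
    also have "\<dots> = (\<integral>\<^sup>+y. indicator B y * emeasure U (sball q \<rho> y (r n)) \<partial>V) / h n"
      by (simp only: rot_fubini(1)[OF U V B])
    also have "(\<integral>\<^sup>+y. indicator B y * emeasure U (sball q \<rho> y (r n)) \<partial>V) = (\<integral>\<^sup>+y. indicator B y * h n \<partial>V)"
      by (rule nn_integral_cong) (simp add: rotD(3)[OF V] h(2))
    also have "\<dots> = emeasure V B * h n"
      using B by (subst nn_integral_multc) (auto simp: rotD(2)[OF V] intro!: borel_measurable_indicator)
    also have "emeasure V B * h n / h n = emeasure V B"
      using h0[of n] by (simp add: ennreal_mult_divide_eq)
    finally show "(\<integral>\<^sup>+x. G n x \<partial>U) = emeasure V B" .
  qed
  finally show ?thesis by (simp add: B_def Liminf_const)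
qed

lemma rot_unique:
  assumes U: "rot_invariant_prob q \<rho> U" and V: "rot_invariant_prob q \<rho> V"
  shows "U = V"
proof -
  have id: "(\<lambda>x. x) \<in> measurable Z borel" if "rot_invariant_prob q \<rho> Z" for Z
    using measurable_restrict_space1[OF measurable_ident_sets[OF refl, of borel]]
    by (simp only: measurable_cong_sets[OF rotD(2)[OF that] refl])
  have D: "emeasure (distr Z borel (\<lambda>x. x)) A = emeasure Z (A \<inter> sphere_hyper q \<rho>)"
    if "rot_invariant_prob q \<rho> Z" "A \<in> sets borel" for Z A
    using emeasure_distr[OF id[OF that(1)] that(2)] by (simp add: rotD(3)[OF that(1)])
  have "distr U borel (\<lambda>x. x) = distr V borel (\<lambda>x. x)"
  proof (rule measure_eqI_generator_eq[where E="{S. open S}" and \<Omega>=UNIV and A="\<lambda>_. UNIV"])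
    show "Int_stable {S :: (nat \<Rightarrow> real) set. open S}" by (auto simp: Int_stable_def)
    fix X :: "(nat \<Rightarrow> real) set" assume "X \<in> {S. open S}"
    then have X: "open X" by simp
    show "emeasure (distr U borel (\<lambda>x. x)) X = emeasure (distr V borel (\<lambda>x. x)) X"
      using rot_open_le[OF U V X] rot_open_le[OF V U X] X by (simp add: D U V)
  next
    show "emeasure (distr U borel (\<lambda>x. x)) UNIV \<noteq> \<infinity>"
      using finite_measure.emeasure_finite[OF prob_space.finite_measure[OF rotD(1)[OF U]]]
      by (simp add: D U)
  qed (auto simp: sets_borel)
  then have eq: "emeasure U (A \<inter> sphere_hyper q \<rho>) = emeasure V (A \<inter> sphere_hyper q \<rho>)"
    if "A \<in> sets borel" for A using D[OF U that] D[OF V that] by simp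
  show ?thesis
  proof (rule measure_eqI)
    fix A assume "A \<in> sets U"
    then obtain B where "B \<in> sets borel" "A = B \<inter> sphere_hyper q \<rho>"
      by (auto simp: rotD(2)[OF U] sets_restrict_space)
    then show "emeasure U A = emeasure V A" using eq by simp
  qed (simp add: rotD(2)[OF U] rotD(2)[OF V])
qed

lemma rot_ex1:
  assumes "q \<ge> 2" "\<rho> > 0" shows "\<exists>!U. rot_invariant_prob q \<rho> U"
  using unif_gauss_invariant[OF assms] rot_unique by blast

lemma unif_sphere_eq:
  assumes "q \<ge> 2" "\<rho> > 0" shows "unif_sphere q \<rho> = unif_gauss q \<rho>"
  unfolding unif_sphere_def
  using unif_gauss_invariant[OF assms] rot_unique by (intro the_equality) blast+

lemma unif_sphere_invariant:
  assumes "q \<ge> 2" "\<rho> > 0" shows "rot_invariant_prob q \<rho> (unif_sphere q \<rho>)"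
  using unif_gauss_invariant[OF assms] by (simp add: unif_sphere_eq[OF assms])


subsection \<open>The regular configurations are admissible\<close>

lemma ybar_component: "i \<in> {1..q} \<Longrightarrow> ybar q i = - (real q - 1) / 2 + (real i - 1)"
  by (simp add: ybar_def xbar_def evec_def field_simps)

lemma proj_xbar: "proj q (xbar q) = ybar q"
proof
  fix i
  have "(\<Sum>j=1..q. xbar q j) = (\<Sum>j=1..q. real j)" by (intro sum.cong) (auto simp: xbar_def)
  also have "\<dots> = real q * (real q + 1) / 2" by (induction q) (auto simp: field_simps)
  finally show "proj q (xbar q) i = ybar q i"
    by (auto simp: proj_def ybar_def xbar_def evec_def)
qed

lemma xbar_ordered: "xbar q \<in> Rvec q" "strict_mono_on {1..q} (xbar q)"
  by (auto simp: Rvec_def xbar_def strict_mono_on_def)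

lemma ybar_admissible:
  assumes "q \<ge> 2" shows "ybar q \<in> hyper_le q" "enorm q (ybar q) > 0"
proof -
  have "ybar q \<in> hyper q" using proj_in_hyper[of q "xbar q"] by (simp only: proj_xbar)
  then show "ybar q \<in> hyper_le q" by (auto simp: hyper_le_def mono_on_def ybar_component)
  have "ybar q 1 \<noteq> 0" using assms ybar_component[of 1 q] by simp
  then have "enorm q (ybar q) \<noteq> 0" using assms by (auto simp: L2_set_eq_0_iff)
  then show "enorm q (ybar q) > 0" using L2_set_nonneg[of "ybar q" "{1..q}"] by linarith
qed

end

theory Submission
  imports Defs
begin

text \<open>
  The largest component \<open>(q - 1) / 2\<close> of \<open>ybar q\<close> is less than \<open>sqrt (3 / q)\<close> times its norm. Hence
  the cap \<open>{v. v 1 > (q - 1) / 2}\<close> of the sphere, centered at the projection of the first unit vector,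
  contains no permutation of \<open>ybar q\<close>. By the Gaussian representation of the uniform distribution,
  its measure is close to the probability that a standard normal variable exceeds \<open>sqrt 3\<close>; a lower
  bound independent of \<open>q\<close> suffices, and Markov's inequality for the sum of squares of the other
  coordinates gives half the probability of exceeding 10.
\<close>

section \<open>Tails and second moments of Gaussian vectors\<close>

lemma nn_integral_std_normal_square:
  "(\<integral>\<^sup>+x. ennreal (x\<^sup>2) \<partial>density lborel std_normal_density) = 1"
proof -
  have I: "has_bochner_integral lborel (\<lambda>x. std_normal_density x * x\<^sup>2) 1"
    using std_normal_moment_even[of 1] by simp
  have "(\<integral>\<^sup>+x. ennreal (x\<^sup>2) \<partial>density lborel std_normal_density)
      = (\<integral>\<^sup>+x. ennreal (std_normal_density x * x\<^sup>2) \<partial>lborel)"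
    by (subst nn_integral_density) (auto simp: ennreal_mult)
  also have "\<dots> = 1"
    using I by (subst nn_integral_eq_integral) (auto simp: has_bochner_integral_iff)
  finally show ?thesis .
qed

text \<open>The density is positive everywhere, so a null half-line would make the interval from
  \<open>a\<close> to \<open>a+1\<close>, of length 1, a Lebesgue null set. Positivity is what keeps
  the final lower bound away from 0.\<close>

lemma emeasure_std_normal_greaterThan_pos:
  "emeasure (density lborel std_normal_density) {a<..} \<noteq> 0"
proof
  assume "emeasure (density lborel std_normal_density) {a<..} = 0"
  then have "{a<..} \<in> null_sets (density lborel std_normal_density)"
    by (auto simp: null_sets_def)
  then have "AE x in lborel. x \<in> {a<..} \<longrightarrow> ennreal (std_normal_density x) = 0"
    by (subst (asm) null_sets_density_iff) auto
  then have "AE x in lborel. x \<notin> {a<..}"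
  proof eventually_elim
    case (elim x)
    then show ?case using normal_density_pos[of 1 0 x] by (auto simp: ennreal_eq_0_iff)
  qed
  then have "AE x in lborel. x \<notin> {a<..<a+1}" by eventually_elim auto
  then have "emeasure lborel {a<..<a+1} = 0"
    by (subst AE_iff_measurable[symmetric, where P="\<lambda>x. x \<notin> {a<..<a+1}"]) auto
  then show False by simp
qed

definition std_normal_tail :: "real \<Rightarrow> ennreal" where
  "std_normal_tail a = emeasure (density lborel std_normal_density) {a<..}"

lemma nn_integral_gauss_prod:
  assumes "\<And>i. i \<in> {1..q} \<Longrightarrow> f i \<in> borel_measurable borel"
  shows "(\<integral>\<^sup>+x. (\<Prod>i\<in>{1..q}. f i (x i)) \<partial>gauss q)
       = (\<Prod>i\<in>{1..q}. \<integral>\<^sup>+x. f i x \<partial>density lborel std_normal_density)"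
proof -
  interpret product_sigma_finite "\<lambda>_::nat. density lborel (\<lambda>x. ennreal (std_normal_density x))"
    unfolding product_sigma_finite_def
    by (intro allI prob_space_imp_sigma_finite prob_space_normal_density) simp
  show ?thesis using assms by (intro product_nn_integral_prod) auto
qed

lemma gauss_coord: "i \<in> {1..q} \<Longrightarrow> (\<lambda>x. x i) \<in> borel_measurable (gauss q)"
  using LB_coord[of i q] by (simp only: measurable_cong_sets[OF sets_gauss refl])

lemma std_normal_total: "emeasure (density lborel std_normal_density) UNIV = 1"
  using prob_space.emeasure_space_1[OF prob_space_normal_density[of 1 0]] by simp

lemma gauss_first_coord_tail:
  assumes "q \<ge> 1"
  shows "(\<integral>\<^sup>+x. indicator {a<..} (x 1) \<partial>gauss q) = std_normal_tail a"
proof -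
  \<comment> \<open>Factors 1 at the other coordinates turn the integrand into a product over all of
    \<open>{1..q}\<close>, as \<open>nn_integral_gauss_prod\<close> requires.\<close>
  define f :: "nat \<Rightarrow> real \<Rightarrow> ennreal" where "f i x = (if i = 1 then indicator {a<..} x else 1)" for i x
  have "(\<integral>\<^sup>+x. indicator {a<..} (x 1) \<partial>gauss q) = (\<integral>\<^sup>+x. (\<Prod>i\<in>{1..q}. f i (x i)) \<partial>gauss q)"
    using assms by (intro nn_integral_cong) (simp add: f_def prod.delta)
  also have "\<dots> = (\<Prod>i\<in>{1..q}. \<integral>\<^sup>+x. f i x \<partial>density lborel std_normal_density)"
    by (rule nn_integral_gauss_prod) (auto simp: f_def)
  also have "\<dots> = (\<Prod>i\<in>{1..q}. if i = 1 then std_normal_tail a else 1)"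
    by (intro prod.cong refl) (auto simp: f_def std_normal_tail_def std_normal_total)
  finally show ?thesis using assms by (simp add: prod.delta)
qed

text \<open>Independence of the coordinates 1 and \<open>j\<close>, together with the second moment
  1 of coordinate \<open>j\<close>. The range of \<open>j\<close> starts at 2, so the two are
  distinct.\<close>

lemma gauss_first_coord_tail_square:
  assumes j: "j \<in> {2..q}"
  shows "(\<integral>\<^sup>+x. indicator {a<..} (x 1) * ennreal ((x j)\<^sup>2) \<partial>gauss q) = std_normal_tail a"
proof -
  define f :: "nat \<Rightarrow> real \<Rightarrow> ennreal" where
    "f i x = (if i = 1 then indicator {a<..} x else if i = j then ennreal (x\<^sup>2) else 1)" for i x
  have prod2: "(\<Prod>i\<in>{1..q}. if i = 1 then u else if i = j then v else 1) = u * v" for u v :: ennreal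
  proof -
    have "(\<Prod>i\<in>{1..q}. if i = 1 then u else if i = j then v else 1)
        = (\<Prod>i\<in>{1..q}. (if i = 1 then u else 1) * (if i = j then v else 1))"
      using j by (intro prod.cong) auto
    then show ?thesis using j by (simp add: prod.distrib prod.delta)
  qed
  have "(\<integral>\<^sup>+x. indicator {a<..} (x 1) * ennreal ((x j)\<^sup>2) \<partial>gauss q)
      = (\<integral>\<^sup>+x. (\<Prod>i\<in>{1..q}. f i (x i)) \<partial>gauss q)"
  proof (intro nn_integral_cong)
    fix x :: "nat \<Rightarrow> real"
    have "(\<Prod>i\<in>{1..q}. f i (x i)) = (\<Prod>i\<in>{1..q}.
        if i = 1 then indicator {a<..} (x 1) else if i = j then ennreal ((x j)\<^sup>2) else 1)"
      by (intro prod.cong refl) (auto simp: f_def)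
    then show "indicator {a<..} (x 1) * ennreal ((x j)\<^sup>2) = (\<Prod>i\<in>{1..q}. f i (x i))"
      unfolding prod2 by simp
  qed
  also have "\<dots> = (\<Prod>i\<in>{1..q}. \<integral>\<^sup>+x. f i x \<partial>density lborel std_normal_density)"
    by (rule nn_integral_gauss_prod) (auto simp: f_def)
  also have "\<dots> = (\<Prod>i\<in>{1..q}. if i = 1 then std_normal_tail a else if i = j then 1 else 1)"
  proof (intro prod.cong refl)
    fix i
    show "(\<integral>\<^sup>+x. f i x \<partial>density lborel std_normal_density)
        = (if i = 1 then std_normal_tail a else if i = j then 1 else 1)"
      by (cases "i = 1"; cases "i = j")
        (auto simp: f_def std_normal_tail_def std_normal_total nn_integral_std_normal_square)
  qed
  finally show ?thesis unfolding prod2 by simp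
qed

text \<open>By independence, the sum of squares integrated over the event \<open>x 1 > a\<close> is
  \<open>q - 1\<close> times the probability of that event. Markov's inequality at level
  \<open>2 * q\<close> therefore removes at most half of the event.\<close>

lemma gauss_tail_and_bounded_rest:
  assumes q: "q \<ge> 1"
  shows "std_normal_tail a / 2
    \<le> emeasure (gauss q) {x \<in> space (gauss q). x 1 > a \<and> (\<Sum>j=2..q. (x j)\<^sup>2) < 2 * real q}"
proof -
  define M where "M = gauss q"
  interpret G: prob_space M unfolding M_def by (rule gauss_prob)
  define R where "R x = (\<Sum>j=2..q. (x j)\<^sup>2)" for x :: "nat \<Rightarrow> real"
  define A where "A = {x \<in> space M. x 1 > a}"
  define B where "B = {x \<in> space M. x 1 > a \<and> R x \<ge> 2 * real q}"
  define p where "p = std_normal_tail a"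
  have X [measurable]: "(\<lambda>x. x j) \<in> borel_measurable M" if "j \<in> {1..q}" for j
    unfolding M_def by (rule gauss_coord[OF that])
  have R: "R \<in> borel_measurable M"
    unfolding R_def by (intro borel_measurable_sum borel_measurable_power X) auto
  have A_eq: "A = (\<lambda>x. x 1) -` {a<..} \<inter> space M" by (auto simp: A_def)
  have B_eq: "B = A \<inter> (R -` {2 * real q..} \<inter> space M)" by (auto simp: A_def B_def)
  have A_sets: "A \<in> sets M"
    unfolding A_eq by (rule measurable_sets[OF X]) (use q in auto)
  have B_sets: "B \<in> sets M"
    unfolding B_eq by (intro sets.Int A_sets measurable_sets[OF R]) auto
  have A: "emeasure M A = p"
  proof -
    have "emeasure M A = (\<integral>\<^sup>+x. indicator A x \<partial>M)"
      by (rule nn_integral_indicator[OF A_sets, symmetric])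
    also have "\<dots> = (\<integral>\<^sup>+x. indicator {a<..} (x 1) \<partial>M)"
      by (intro nn_integral_cong) (auto simp: A_def indicator_def)
    finally show ?thesis unfolding M_def p_def using gauss_first_coord_tail[OF q] by simp
  qed
  \<comment> \<open>Markov's inequality in multiplied form: on \<open>B\<close> the sum of squares
    is at least \<open>2 * q\<close>.\<close>
  have "ennreal (2 * real q) * emeasure M B
      = (\<integral>\<^sup>+x. ennreal (2 * real q) * indicator B x \<partial>M)"
    by (rule nn_integral_cmult_indicator[OF B_sets, symmetric])
  also have "\<dots> \<le> (\<integral>\<^sup>+x. (\<Sum>j=2..q. indicator {a<..} (x 1) * ennreal ((x j)\<^sup>2)) \<partial>M)"
  proof (rule nn_integral_mono)
    fix x
    have "(\<Sum>j=2..q. indicator {a<..} (x 1) * ennreal ((x j)\<^sup>2)) = indicator {a<..} (x 1) * ennreal (R x)"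
      by (simp add: R_def sum_ennreal flip: sum_distrib_left)
    then show "ennreal (2 * real q) * indicator B x
        \<le> (\<Sum>j=2..q. indicator {a<..} (x 1) * ennreal ((x j)\<^sup>2))"
      by (auto simp: B_def indicator_def intro!: ennreal_leI)
  qed
  also have "\<dots> = (\<Sum>j=2..q. \<integral>\<^sup>+x. indicator {a<..} (x 1) * ennreal ((x j)\<^sup>2) \<partial>M)"
    by (rule nn_integral_sum) measurable
  also have "\<dots> = (\<Sum>j=2..q. p)"
    by (intro sum.cong refl) (simp only: gauss_first_coord_tail_square p_def M_def)
  also have "\<dots> \<le> ennreal (real q) * p"
    by (auto simp: ennreal_of_nat_eq_real_of_nat[symmetric] intro!: mult_right_mono of_nat_mono)
  finally have B: "ennreal (2 * real q) * emeasure M B \<le> ennreal (real q) * p" .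
  have p: "p = ennreal (measure M A)" using A G.emeasure_eq_measure by metis
  have "2 * real q * measure M B \<le> real q * measure M A"
    using B unfolding p G.emeasure_eq_measure by (simp add: ennreal_mult[symmetric])
  then have half: "measure M B \<le> measure M A / 2" using q by simp
  have "measure M (A - B) = measure M A - measure M B"
    by (rule G.finite_measure_Diff[OF A_sets B_sets]) (auto simp: B_eq)
  then have "measure M A / 2 \<le> measure M (A - B)" using half by simp
  then have "ennreal (measure M A / 2) \<le> emeasure M (A - B)"
    unfolding G.emeasure_eq_measure by (rule ennreal_leI)
  moreover have "A - B = {x \<in> space M. x 1 > a \<and> R x < 2 * real q}"
    by (auto simp: A_def B_def)
  moreover have "std_normal_tail a / 2 = ennreal (measure M A / 2)"
    using divide_ennreal[of "measure M A" 2] by (simp add: p_def[symmetric] p)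
  ultimately show ?thesis unfolding R_def M_def by simp
qed

section \<open>The norm of the regular configuration, and caps cut out by the first
  coordinate\<close>

lemma enorm_ybar_sq: "(enorm q (ybar q))\<^sup>2 = real q * ((real q)\<^sup>2 - 1) / 12"
proof -
  \<comment> \<open>An arbitrary center \<open>b\<close> makes induction possible; the intended
    center \<open>(q + 1) / 2\<close> itself varies with \<open>q\<close>.\<close>
  have *: "(\<Sum>i=1..q. (real i - b)\<^sup>2)
      = real q * (real q + 1) * (2 * real q + 1) / 6 - b * real q * (real q + 1) + real q * b\<^sup>2" for b
    by (induction q) (auto simp: field_simps power2_eq_square)
  have "(enorm q (ybar q))\<^sup>2 = (\<Sum>i=1..q. (real i - (real q + 1) / 2)\<^sup>2)"
    unfolding enorm_sq dotp_def
    by (intro sum.cong refl) (auto simp: ybar_def xbar_def evec_def power2_eq_square)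
  then show ?thesis unfolding * by (simp add: field_simps power2_eq_square)
qed

text \<open>On the hyperplane, the projected unit vector represents the coordinate functional, since
  it differs from the unit vector by a multiple of \<open>evec q\<close>. This makes half-spaces in
  one coordinate into caps.\<close>

lemma dotp_proj_bvec:
  assumes v: "v \<in> hyper q" and j: "j \<in> {1..q}"
  shows "dotp q v (proj q (bvec j)) = v j"
proof -
  have "(\<Sum>i=1..q. bvec j i) = 1" using j by (simp add: bvec_def)
  then have "dotp q v (proj q (bvec j)) = (\<Sum>i=1..q. v i * bvec j i - v i / real q)"
    unfolding dotp_def proj_def by (intro sum.cong refl) (simp add: algebra_simps)
  also have "\<dots> = (\<Sum>i=1..q. v i * bvec j i) - (\<Sum>i=1..q. v i) / real q"
    by (simp add: sum_subtractf sum_divide_distrib)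
  also have "\<dots> = v j"
    using v j by (simp add: hyper_iff bvec_def if_distrib[where f="\<lambda>x. _ * x"] cong: if_cong)
  finally show ?thesis .
qed

text \<open>Described by the height of the boundary rather than by a center and a cosine, so that
  membership is tested on a single component.\<close>

definition coord_cap :: "nat \<Rightarrow> real \<Rightarrow> real \<Rightarrow> (nat \<Rightarrow> real) set" where
  "coord_cap q \<rho> c = {v \<in> sphere_hyper q \<rho>. v 1 > c}"

text \<open>The center is the projected first unit vector, whose norm is
  \<open>s = sqrt (1 - 1 / q)\<close>, rescaled to norm \<open>\<rho>\<close>. The inner product of
  \<open>v\<close> with it is \<open>\<rho> / s * v 1\<close>, which converts the cosine
  \<open>t\<close> into the height \<open>\<rho> * s * t\<close>.\<close>

lemma coord_cap_eq_cap:
  assumes q: "q \<ge> 2" and \<rho>: "\<rho> > 0"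
  obtains w where "w \<in> sphere_hyper q \<rho>" "\<And>t. cap q w t = coord_cap q \<rho> (\<rho> * sqrt (1 - 1 / real q) * t)"
proof -
  define u where "u = proj q (bvec 1)"
  define s where "s = sqrt (1 - 1 / real q)"
  have s: "s > 0" using q by (simp add: s_def)
  have u: "u \<in> hyper q" unfolding u_def by (rule proj_in_hyper)
  have du: "dotp q v u = v 1" if "v \<in> hyper q" for v
    unfolding u_def using that q by (intro dotp_proj_bvec) auto
  have "(\<Sum>i=1..q. bvec 1 i) = 1" using q by (simp add: bvec_def)
  then have "u 1 = 1 - 1 / real q" using q by (simp add: u_def proj_def bvec_def)
  then have nu: "enorm q u = s"
    using du[OF u] enorm_sq[where q=q and v=u] L2_set_nonneg[of u "{1..q}"]
    by (simp add: s_def real_sqrt_unique)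
  define w where "w = (\<lambda>i. \<rho> / s * u i)"
  have nw: "enorm q w = \<rho>" unfolding w_def enorm_scale nu using s \<rho> by simp
  have w: "w \<in> sphere_hyper q \<rho>"
    using hyper_scale[OF u, of "\<rho> / s"] nw by (simp add: sphere_hyper_def w_def)
  have "dotp q v w > \<rho>\<^sup>2 * t \<longleftrightarrow> v 1 > \<rho> * s * t" if "v \<in> hyper q" for v t
  proof -
    have "dotp q v w = \<rho> / s * v 1"
      using du[OF that] dotp_scale[of q "\<rho> / s" u v] by (simp only: w_def dotp_commute[of q v])
    then have "dotp q v w > \<rho>\<^sup>2 * t \<longleftrightarrow> \<rho>\<^sup>2 * t < \<rho> * v 1 / s" by simp
    also have "\<dots> \<longleftrightarrow> \<rho> * (\<rho> * s * t) < \<rho> * v 1"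
      using s by (simp add: pos_less_divide_eq power2_eq_square ac_simps)
    finally show ?thesis using \<rho> by (simp add: ac_simps)
  qed
  then have "cap q w t = coord_cap q \<rho> (\<rho> * s * t)" for t
    unfolding cap_def coord_cap_def nw by (auto simp: sphere_hyper_def)
  with w show thesis unfolding s_def by (rule that)
qed

section \<open>A lower bound, independent of the dimension, for the measure of the empty cap\<close>

text \<open>
  The threshold of \<open>sqrt 3\<close> standard deviations is an upper bound for the largest component of a
  regular configuration, measured in the same way.
\<close>

lemma first_coord_outlier:
  assumes q: "q \<ge> 100" and x1: "x 1 > 10" and R: "(\<Sum>j=2..q. (x j)\<^sup>2) < 2 * real q"
  shows "proj q x 1 > 0" "3 * (enorm q (proj q x))\<^sup>2 < real q * (proj q x 1)\<^sup>2"
proof -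
  define S where "S = (\<Sum>j=2..q. x j)"
  define Q where "Q = real q"
  have Q: "Q \<ge> 100" using q by (simp add: Q_def)
  have E: "{1..q} = insert 1 {2..q}" using q by auto
  have "S\<^sup>2 \<le> (\<Sum>j=2..q. (x j)\<^sup>2) * real (card {2..q})"
    unfolding S_def using Cauchy_Schwarz_ineq_sum[of x "\<lambda>_. 1" "{2..q}"] by simp
  \<comment> \<open>After Cauchy-Schwarz, the constant 3/2 serves as a rational upper bound for the
    square root of 2.\<close>
  also have "\<dots> \<le> (2 * Q) * Q"
    using R q unfolding Q_def by (intro mult_mono) auto
  also have "\<dots> \<le> (3 / 2 * Q)\<^sup>2" by (simp add: power2_eq_square)
  finally have S: "S \<le> 3 / 2 * Q"
    by (rule power2_le_imp_le) (use Q in simp)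
  have m: "mean q x = x 1 / Q + S / Q"
    unfolding mean_def S_def Q_def E by (simp add: add_divide_distrib)
  have "x 1 / Q \<le> x 1 / 100" using Q x1 by (intro divide_left_mono) auto
  moreover have "S / Q \<le> 3 / 2" using S Q by (simp add: field_simps)
  \<comment> \<open>Subtracting the mean costs at most \<open>x 1 / 100 + 3 / 2\<close>, little
    compared with \<open>x 1 > 10\<close>.\<close>
  ultimately have p1: "proj q x 1 \<ge> 99 / 100 * x 1 - 3 / 2"
    using proj_mean[of 1 q x] q m by simp
  show "proj q x 1 > 0" using p1 x1 by simp
  have "(enorm q (proj q x))\<^sup>2 \<le> dotp q x x"
    unfolding enorm_sq
    using dotp_expand_mean[where q=q and x=x and v="proj q x" and m="mean q x", OF proj_in_hyper proj_mean]
    by simp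
  also have "\<dots> < (x 1)\<^sup>2 + 2 * Q"
    using R unfolding dotp_def E Q_def by (simp add: power2_eq_square)
  finally have "3 * (enorm q (proj q x))\<^sup>2 < 3 * (x 1)\<^sup>2 + 6 * Q" by simp
  also have "\<dots> \<le> Q * (99 / 100 * x 1 - 3 / 2)\<^sup>2"
  proof -
    have "100 * (x 1)\<^sup>2 \<le> Q * (x 1)\<^sup>2" using Q by (intro mult_right_mono) auto
    moreover have "Q * 10\<^sup>2 \<le> Q * (x 1)\<^sup>2" using x1 Q by (intro mult_left_mono power_mono) auto
    \<comment> \<open>The two summands are at most 3/100 and 6/100 of \<open>Q\<close> times the
      square of \<open>x 1\<close>. The generous 64/100 is the square of 8/10, and
      \<open>8 / 10 * x 1\<close> stays below \<open>99 / 100 * x 1 - 3 / 2\<close> because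
      \<open>x 1 > 10\<close>.\<close>
    ultimately have "3 * (x 1)\<^sup>2 + 6 * Q \<le> 64 / 100 * (Q * (x 1)\<^sup>2)"
      using Q zero_le_power2[of "x 1"] unfolding power2_eq_square[of "10 :: real"] by linarith
    also have "\<dots> = Q * (8 / 10 * x 1)\<^sup>2" by (simp add: power_mult_distrib power_divide)
    also have "\<dots> \<le> Q * (99 / 100 * x 1 - 3 / 2)\<^sup>2"
      using x1 Q by (intro mult_left_mono power_mono) auto
    finally show ?thesis .
  qed
  also have "\<dots> \<le> Q * (proj q x 1)\<^sup>2"
    using p1 x1 Q by (intro mult_left_mono power_mono) auto
  finally show "3 * (enorm q (proj q x))\<^sup>2 < real q * (proj q x 1)\<^sup>2" by (simp add: Q_def)
qed

lemma coord_cap_sets: "coord_cap q \<rho> c \<in> sets (SB q \<rho>)"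
proof -
  have "open {v :: nat \<Rightarrow> real. v 1 > c}"
    by (intro open_Collect_less continuous_intros continuous_on_product_coordinates)
  moreover have "coord_cap q \<rho> c = sphere_hyper q \<rho> \<inter> {v. v 1 > c}" by (auto simp: coord_cap_def)
  ultimately show ?thesis by (auto simp: sets_restrict_space)
qed

text \<open>The projected vector has first component above \<open>sqrt (3 / q)\<close> times its
  norm, while \<open>(q - 1) / 2\<close> is at most \<open>sqrt (3 / q)\<close> times the radius.
  Both comparisons are made between squares to avoid roots.\<close>

lemma ndir_in_coord_cap:
  assumes q: "q \<ge> 100" and x1: "x 1 > 10" and R: "(\<Sum>j=2..q. (x j)\<^sup>2) < 2 * real q"
  shows "ndir q (enorm q (ybar q)) x \<in> coord_cap q (enorm q (ybar q)) ((real q - 1) / 2)"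
proof -
  define \<rho> where "\<rho> = enorm q (ybar q)"
  define n where "n = enorm q (proj q x)"
  have \<rho>: "\<rho> > 0" unfolding \<rho>_def using q by (intro ybar_admissible) simp
  note out = first_coord_outlier[OF assms]
  \<comment> \<open>A nonzero projection keeps \<open>ndir\<close> away from its fallback
    value.\<close>
  have "n \<noteq> 0"
  proof
    assume "n = 0"
    moreover have "1 \<in> {1..q}" using q by simp
    ultimately have "proj q x 1 = 0"
      unfolding n_def L2_set_eq_0_iff[OF finite_atLeastAtMost] by (rule bspec)
    with out(1) show False by simp
  qed
  moreover have "n \<ge> 0" unfolding n_def by (rule L2_set_nonneg)
  ultimately have n: "n > 0" by simp
  define c where "c = (real q - 1) / 2"
  have "3 * (c * n)\<^sup>2 = c\<^sup>2 * (3 * n\<^sup>2)" by (simp add: power_mult_distrib)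
  also have "\<dots> < c\<^sup>2 * (real q * (proj q x 1)\<^sup>2)"
    using out(2) q by (intro mult_strict_left_mono) (auto simp: c_def n_def)
  also have "\<dots> = (real q * c\<^sup>2) * (proj q x 1)\<^sup>2" by simp
  also have "\<dots> \<le> (3 * \<rho>\<^sup>2) * (proj q x 1)\<^sup>2"
  proof (rule mult_right_mono)
    \<comment> \<open>Multiplied by \<open>q / 4\<close>, this is the required bound, because three
      times the squared radius equals \<open>q / 4\<close> times the right-hand side.\<close>
    have "(real q - 1)\<^sup>2 \<le> (real q)\<^sup>2 - 1"
      using q by (simp add: power2_eq_square algebra_simps)
    then have "real q * (real q - 1)\<^sup>2 \<le> real q * ((real q)\<^sup>2 - 1)"
      by (rule mult_left_mono) simp
    then show "real q * c\<^sup>2 \<le> 3 * \<rho>\<^sup>2"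
      unfolding \<rho>_def enorm_ybar_sq c_def power_divide power2_eq_square[of "2 :: real"]
      by linarith
  qed simp
  finally have "(c * n)\<^sup>2 < (\<rho> * proj q x 1)\<^sup>2" by (simp add: power_mult_distrib)
  then have "c * n < \<rho> * proj q x 1"
    by (rule power2_less_imp_less) (use out(1) \<rho> in simp)
  then have "c < \<rho> / n * proj q x 1" using n by (simp add: field_simps)
  then have "c < ndir q \<rho> x 1" using n by (simp add: ndir_def n_def)
  then show ?thesis
    using ndir_sphere[of q \<rho> x] q \<rho> by (simp add: coord_cap_def \<rho>_def c_def)
qed

text \<open>The uniform distribution is the image of the Gaussian measure under \<open>ndir\<close>,
  and the preimage of the cap contains the Gaussian event estimated above.\<close>

lemma unif_sphere_coord_cap_ge:
  assumes q: "q \<ge> 100"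
  shows "std_normal_tail 10 / 2
    \<le> emeasure (unif_sphere q (enorm q (ybar q))) (coord_cap q (enorm q (ybar q)) ((real q - 1) / 2))"
proof -
  define \<rho> where "\<rho> = enorm q (ybar q)"
  define C where "C = coord_cap q \<rho> ((real q - 1) / 2)"
  have \<rho>: "\<rho> > 0" unfolding \<rho>_def using q by (intro ybar_admissible) simp
  have q2: "q \<ge> 2" using q by simp
  have nm: "ndir q \<rho> \<in> measurable (gauss q) (SB q \<rho>)"
    using ndir_measurable[OF q2 \<rho>] by (simp only: measurable_cong_sets[OF sets_gauss refl])
  have C: "C \<in> sets (SB q \<rho>)" unfolding C_def by (rule coord_cap_sets)
  have "std_normal_tail 10 / 2
    \<le> emeasure (gauss q) {x \<in> space (gauss q). x 1 > 10 \<and> (\<Sum>j=2..q. (x j)\<^sup>2) < 2 * real q}"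
    using q by (intro gauss_tail_and_bounded_rest) simp
  also have "\<dots> \<le> emeasure (gauss q) (ndir q \<rho> -` C \<inter> space (gauss q))"
    using ndir_in_coord_cap[OF q] measurable_sets[OF nm C]
    by (intro emeasure_mono) (auto simp: C_def \<rho>_def simp del: One_nat_def)
  also have "\<dots> = emeasure (unif_sphere q \<rho>) C"
    unfolding unif_sphere_eq[OF q2 \<rho>] unif_gauss_def by (rule emeasure_distr[OF nm C, symmetric])
  finally show ?thesis by (simp add: C_def \<rho>_def)
qed

section \<open>Emptiness and angular width of the cap\<close>

text \<open>The height is exactly the largest component of \<open>ybar q\<close>. Since caps are
  open, permutations with this component in first place lie on the boundary and are
  excluded.\<close>

lemma perms_ybar_coord_cap:
  assumes q: "q \<ge> 1"
  shows "perms q (ybar q) \<inter> coord_cap q \<rho> ((real q - 1) / 2) = {}"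
proof -
  have "ybar q (\<pi> 1) \<le> (real q - 1) / 2" if \<pi>: "\<pi> permutes {1..q}" for \<pi>
  proof -
    have i: "\<pi> 1 \<in> {1..q}" using permutes_in_image[OF \<pi>, of 1] q by simp
    then have "real (\<pi> 1) \<le> real q" by simp
    then show ?thesis unfolding ybar_component[OF i] by (simp add: field_simps)
  qed
  then show ?thesis by (fastforce simp: perms_def coord_cap_def simp del: One_nat_def)
qed

lemma empty_cap_ybar:
  assumes q: "q \<ge> 100"
  obtains w t where "w \<in> sphere_hyper q (enorm q (ybar q))" "0 \<le> t" "t \<le> 1 / 2"
    "cap q w t = coord_cap q (enorm q (ybar q)) ((real q - 1) / 2)"
proof -
  define \<rho> where "\<rho> = enorm q (ybar q)"
  have \<rho>: "\<rho> > 0" unfolding \<rho>_def using q by (intro ybar_admissible) simp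
  have q2: "q \<ge> 2" using q by simp
  obtain w where w: "w \<in> sphere_hyper q \<rho>"
    "\<And>t. cap q w t = coord_cap q \<rho> (\<rho> * sqrt (1 - 1 / real q) * t)"
    using coord_cap_eq_cap[OF q2 \<rho>] by metis
  \<comment> \<open>The cosine is found by solving
    \<open>\<rho> * sqrt (1 - 1 / q) * t = (q - 1) / 2\<close> with the known radius. The bound 1/2
    on it gives a half-width of at least \<open>arccos (1 / 2)\<close>, independent of
    \<open>q\<close>.\<close>
  define t where "t = sqrt (3 / (real q + 1))"
  have "t \<le> sqrt ((1 / 2)\<^sup>2)"
    unfolding t_def using q by (intro real_sqrt_le_mono) (simp add: field_simps power2_eq_square)
  then have t: "0 \<le> t" "t \<le> 1 / 2" unfolding t_def by auto
  have sq: "(\<rho> * sqrt (1 - 1 / real q) * t)\<^sup>2 = ((real q - 1) / 2)\<^sup>2"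
  proof -
    have "(\<rho> * sqrt (1 - 1 / real q) * t)\<^sup>2 = \<rho>\<^sup>2 * (1 - 1 / real q) * (3 / (real q + 1))"
      using q by (simp add: power_mult_distrib t_def)
    also have "\<rho>\<^sup>2 = real q * (real q - 1) * (real q + 1) / 12"
      unfolding \<rho>_def enorm_ybar_sq by (simp add: algebra_simps power2_eq_square)
    also have "real q * (real q - 1) * (real q + 1) / 12 * (1 - 1 / real q) * (3 / (real q + 1)) = ((real q - 1) / 2)\<^sup>2"
      using q by (simp add: divide_simps) (simp add: algebra_simps power2_eq_square)
    finally show ?thesis .
  qed
  have "\<rho> * sqrt (1 - 1 / real q) * t = (real q - 1) / 2"
    by (rule power2_eq_imp_eq[OF sq]) (use \<rho> q t in auto)
  then have "cap q w t = coord_cap q \<rho> ((real q - 1) / 2)" by (simp only: w(2))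
  with w(1) t show thesis unfolding \<rho>_def by (rule that)
qed

section \<open>Failure of the three asymptotic properties\<close>

lemma not_tendsto_0_of_eventually_ge:
  fixes f :: "nat \<Rightarrow> real"
  assumes "\<delta> > 0" "\<And>q. q \<ge> m \<Longrightarrow> \<delta> \<le> f q"
  shows "\<not> f \<longlonglongrightarrow> 0"
proof
  assume "f \<longlonglongrightarrow> 0"
  then have "\<delta> \<le> 0"
    by (rule LIMSEQ_le_const) (use assms(2) in blast)
  with assms(1) show False by simp
qed

theorem proposition3p1:
  shows "(\<not> APF_proj xbar \<and> \<not> APU_proj xbar \<and> \<not> APD_proj xbar) \<and>
         (\<not> APF ybar \<and> \<not> APU ybar \<and> \<not> APD ybar)"
proof -
  define \<rho> where "\<rho> q = enorm q (ybar q)" for q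
  define U where "U q = unif_sphere q (\<rho> q)" for q
  define N where "N q = perms q (ybar q)" for q
  define C where "C q = coord_cap q (\<rho> q) ((real q - 1) / 2)" for q
  define \<delta> where "\<delta> = enn2real (std_normal_tail 10 / 2)"
  \<comment> \<open>Finiteness matters because \<open>enn2real\<close> sends infinity to 0.\<close>
  have fin: "std_normal_tail 10 / 2 < \<top>"
    using finite_measure.emeasure_finite[OF prob_space.finite_measure[OF prob_space_normal_density[of 1 0]]]
    by (simp add: std_normal_tail_def ennreal_divide_eq_top_iff less_top[symmetric])
  then have \<delta>: "\<delta> > 0"
    using emeasure_std_normal_greaterThan_pos[of 10]
    by (auto simp: \<delta>_def enn2real_positive_iff std_normal_tail_def ennreal_zero_less_divide zero_less_iff_neq_zero)
  have prob: "prob_space (U q)" if "q \<ge> 100" for q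
    unfolding U_def \<rho>_def using that
    by (intro rotD(1)[OF unif_sphere_invariant] ybar_admissible) auto
  have meas: "\<delta> \<le> measure (U q) (C q)" if q: "q \<ge> 100" for q
  proof -
    interpret prob_space "U q" by (rule prob[OF q])
    have "ennreal \<delta> \<le> ennreal (measure (U q) (C q))"
      using unif_sphere_coord_cap_ge[OF q] fin
      by (simp add: emeasure_eq_measure[symmetric]) (simp add: \<delta>_def U_def C_def \<rho>_def)
    then show ?thesis by simp
  qed
  have empty: "N q \<inter> C q = {}" if "q \<ge> 100" for q
    unfolding N_def C_def using that by (intro perms_ybar_coord_cap) simp
  have cap: "\<exists>w t. w \<in> sphere_hyper q (\<rho> q) \<and> 0 \<le> t \<and> t \<le> 1 / 2 \<and> cap q w t = C q"
    if "q \<ge> 100" for q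
    unfolding C_def \<rho>_def by (rule empty_cap_ybar[OF that]) blast
  have C: "C q \<in> caps q (\<rho> q)" if q: "q \<ge> 100" for q
  proof -
    obtain w t where "w \<in> sphere_hyper q (\<rho> q)" "0 \<le> t" "t \<le> 1 / 2" "cap q w t = C q"
      using cap[OF q] by blast
    then show ?thesis unfolding caps_def by (intro CollectI exI[of _ w] exI[of _ t]) simp
  qed
  have F: "\<not> APF ybar"
    unfolding APF_def
  proof (rule not_tendsto_0_of_eventually_ge[OF \<delta>])
    fix q :: nat assume q: "q \<ge> 100"
    interpret prob_space "U q" by (rule prob[OF q])
    have "measure (U q) (C q) \<le> empty_cap_discrepancy q (\<rho> q) (N q)"
      unfolding empty_cap_discrepancy_def U_def[symmetric]
      by (rule cSup_upper) (use C[OF q] empty[OF q] in \<open>auto intro!: bdd_aboveI[of _ 1]\<close>)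
    with meas[OF q] show "\<delta> \<le> empty_cap_discrepancy q (enorm q (ybar q)) (perms q (ybar q))"
      by (simp add: \<rho>_def N_def)
  qed
  \<comment> \<open>The same cap refutes uniformity directly: it contains none of the points, so its
    term in the supremum is its measure.\<close>
  have U: "\<not> APU ybar"
    unfolding APU_def
  proof (rule not_tendsto_0_of_eventually_ge[OF \<delta>])
    fix q :: nat assume q: "q \<ge> 100"
    interpret prob_space "U q" by (rule prob[OF q])
    \<comment> \<open>For infinite \<open>N q\<close> the denominator is 0, hence so is the quotient
      by convention.\<close>
    have frac: "real (card (N q \<inter> D)) / real (card (N q)) \<le> 1" for D
      by (cases "finite (N q)") (auto simp: divide_le_eq_1 card_gt_0_iff intro!: card_mono)
    have bound: "\<bar>real (card (N q \<inter> D)) / real (card (N q)) - measure (U q) D\<bar> \<le> 1" for D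
      using frac[of D] prob_le_1[of D] measure_nonneg[of "U q" D]
        divide_nonneg_nonneg[of "real (card (N q \<inter> D))" "real (card (N q))"] by linarith
    have "\<bar>real (card (N q \<inter> C q)) / real (card (N q)) - measure (U q) (C q)\<bar>
        \<le> cap_discrepancy q (\<rho> q) (N q)"
      unfolding cap_discrepancy_def U_def[symmetric]
      by (rule cSup_upper) (use C[OF q] bound in \<open>auto intro!: bdd_aboveI[of _ 1]\<close>)
    with meas[OF q] show "\<delta> \<le> cap_discrepancy q (enorm q (ybar q)) (perms q (ybar q))"
      by (simp add: \<rho>_def N_def empty[OF q, unfolded N_def \<rho>_def])
  qed
  have D: "\<not> APD ybar"
    unfolding APD_def
  proof (rule not_tendsto_0_of_eventually_ge)
    show "arccos (1 / 2) > 0" by (intro arccos_lt_bounded[THEN conjunct1]) auto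
    fix q :: nat assume q: "q \<ge> 100"
    obtain w t where wt: "w \<in> sphere_hyper q (\<rho> q)" "0 \<le> t" "t \<le> 1 / 2" "cap q w t = C q"
      using cap[OF q] by blast
    \<comment> \<open>\<open>arccos\<close> is decreasing, so the upper bound on the cosine bounds
      the angle from below.\<close>
    have "arccos (1 / 2) \<le> arccos t" using wt by (intro arccos_le_arccos) auto
    also have "\<dots> \<le> empty_cap_angular_discrepancy q (\<rho> q) (N q)"
      unfolding empty_cap_angular_discrepancy_def
    proof (rule cSup_upper)
      show "arccos t \<in> {arccos t |t. \<exists>w\<in>sphere_hyper q (\<rho> q). - 1 \<le> t \<and> t < 1 \<and> N q \<inter> cap q w t = {}}"
        using wt empty[OF q] by (auto intro!: exI[of _ t] bexI[of _ w])
    qed (auto intro!: bdd_aboveI[of _ pi] arccos_ubound)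
    finally show "arccos (1 / 2) \<le> empty_cap_angular_discrepancy q (enorm q (ybar q)) (perms q (ybar q))"
      by (simp add: \<rho>_def N_def)
  qed
  \<comment> \<open>The projections of \<open>xbar\<close> are the vectors \<open>ybar\<close>, so
    the statements for \<open>xbar\<close> reduce to those for \<open>ybar\<close>.\<close>
  from F U D show ?thesis
    by (simp add: APF_proj_def APU_proj_def APD_proj_def proj_xbar)
qed

end
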